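(* Let $\rho=(r_n)_n$ be an increasing sequence in $[0,1)$ with $r_n\to1$ as $n\to\infty$. The set of all sequences $(f_j)_j\in H(\mathbb{D})^{\mathbb{N}}$ that freely generate a dense subalgebra of $H(\mathbb{D})$, every non-constant element of which is an Abel universal function, is residual in $H(\mathbb{D})^{\mathbb{N}}$. In particular, $\mathcal{U}_A(\mathbb{D},\rho)$ is densely strongly-algebrable.
   Context: $\mathbb{D}$ is the open unit disc, $\mathbb{T}=\partial\mathbb{D}$ the unit circle, and $H(\mathbb{D})$ the algebra of holomorphic functions on $\mathbb{D}$ (with pointwise operations), endowed with the topology of local uniform convergence; $H(\mathbb{D})^{\mathbb{N}}$ carries the product topology. A subset is residual if it contains a dense $G_\delta$ set. For an increasing sequence $\rho=(r_n)_n$ in $[0,1)$ with $r_n\to1$, $\mathcal{U}_A(\mathbb{D},\rho)$ denotes the set of all $f\in H(\mathbb{D})$ such that: for any compact subset $K\subset\mathbb{T}$, $K\neq\mathbb{T}$, and any continuous function $\varphi:K\to\mathbb{C}$, there exists an increasing sequence $(n_k)_k$ in $\mathbb{N}$ such that $\sup_{\zeta\in K}|f(r_{n_k}\zeta)-\varphi(\zeta)|\to0$ as $k\to\infty$. A function is called Abel universal if it belongs to $\mathcal{U}_A(\mathbb{D})=\bigcup_{\rho}\mathcal{U}_A(\mathbb{D},\rho)$, the union over all such sequences $\rho$. For a unital commutative algebra $X$ over $\mathbb{C}$ with unit $\mathbf{1}$ and $B\subset X$, the subalgebra generated by $B$ is $\mathcal{A}(B)=\{P(b_1,\dots,b_n):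 b_1,\dots,b_n\in B,\ P\in\mathbb{C}[t_1,\dots,t_n],\ n\in\mathbb{N}\}$; if $B$ is algebraically independent, $B$ is said to freely generate $\mathcal{A}(B)$. For $X$ also a topological space, a subset $A\subset X$ is densely strongly-algebrable if $A\cup\{c\cdot\mathbf{1}:c\in\mathbb{C}\}$ contains a subalgebra that is dense in $X$ and freely generated by an infinite set. *)

theory Defs
  imports "HOL-Analysis.Analysis" "HOL-Library.Poly_Mapping"
begin

abbreviation disc :: "complex set"
  where "disc \<equiv> ball 0 1"

abbreviation circle :: "complex set"
  where "circle \<equiv> sphere 0 1"

text \<open>Membership in \<^const>\<open>extensional\<close> fixes the values outside the disc, so that
  equality of elements of \<open>hol_disc\<close> is equality of functions on the disc.\<close>

definition hol_disc :: "(complex \<Rightarrow> complex) set"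
  where "hol_disc = {f \<in> extensional disc. f holomorphic_on disc}"

definition hol_constants :: "(complex \<Rightarrow> complex) set"
  where "hol_constants = range (\<lambda>c. \<lambda>z\<in>disc. c)"

text \<open>The topology of local uniform convergence, i.e. uniform convergence on compact subsets
  of the disc.  The sets \<open>hol_nbhd f K e\<close> form a neighbourhood base at \<open>f\<close>.\<close>

definition hol_nbhd :: "(complex \<Rightarrow> complex) \<Rightarrow> complex set \<Rightarrow> real \<Rightarrow> (complex \<Rightarrow> complex) set"
  where "hol_nbhd f K e = {g \<in> hol_disc. \<forall>z\<in>K. dist (g z) (f z) < e}"

definition hol_open :: "(complex \<Rightarrow> complex) set \<Rightarrow> bool"
  where "hol_open U \<longleftrightarrow> U \<subseteq> hol_disc \<and>
    (\<forall>f\<in>U. \<exists>K e. compact K \<and> K \<subseteq> disc \<and> e > 0 \<and> hol_nbhd f K e \<subseteq> U)"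

definition hol_topology :: "(complex \<Rightarrow> complex) topology"
  where "hol_topology = topology hol_open"

lemma istopology_hol_open: "istopology hol_open"
  unfolding istopology_def
proof (intro conjI allI impI)
  fix S T assume S: "hol_open S" and T: "hol_open T"
  show "hol_open (S \<inter> T)"
    unfolding hol_open_def
  proof (intro conjI ballI)
    show "S \<inter> T \<subseteq> hol_disc" using S by (auto simp: hol_open_def)
  next
    fix f assume f: "f \<in> S \<inter> T"
    obtain K e where K: "compact K" "K \<subseteq> disc" "e > 0" "hol_nbhd f K e \<subseteq> S"
      using S f by (auto simp: hol_open_def)
    obtain L d where L: "compact L" "L \<subseteq> disc" "d > 0" "hol_nbhd f L d \<subseteq> T"
      using T f by (auto simp: hol_open_def)
    have "hol_nbhd f (K \<union> L) (min e d) \<subseteq> hol_nbhd f K e \<inter> hol_nbhd f L d"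
      by (auto simp: hol_nbhd_def)
    with K L have "compact (K \<union> L) \<and> K \<union> L \<subseteq> disc \<and> min e d > 0
        \<and> hol_nbhd f (K \<union> L) (min e d) \<subseteq> S \<inter> T"
      by (auto simp: compact_Un)
    then show "\<exists>K e. compact K \<and> K \<subseteq> disc \<and> e > 0 \<and> hol_nbhd f K e \<subseteq> S \<inter> T"
      by blast
  qed
next
  fix \<K> assume "\<forall>K\<in>\<K>. hol_open K"
  then show "hol_open (\<Union>\<K>)"
    unfolding hol_open_def by (meson UnionE Union_least Union_upper subset_trans)
qed

lemma openin_hol_topology: "openin hol_topology U \<longleftrightarrow> hol_open U"
  by (simp add: hol_topology_def istopology_hol_open topology_inverse')

lemma topspace_hol_topology: "topspace hol_topology = hol_disc"
proof -
  have "hol_open hol_disc"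
    unfolding hol_open_def
    by (auto intro!: exI[of _ "{}"] exI[of _ "1::real"] simp: hol_nbhd_def)
  moreover have "U \<subseteq> hol_disc" if "hol_open U" for U
    using that by (simp add: hol_open_def)
  ultimately show ?thesis
    unfolding topspace_def openin_hol_topology by blast
qed

text \<open>The topology on sequences of elements of \<open>hol_disc\<close>; as the index set is \<open>UNIV\<close>, the
  underlying set consists of all \<open>f :: nat \<Rightarrow> _\<close> with values in \<open>hol_disc\<close>.\<close>

abbreviation hol_seq_topology :: "(nat \<Rightarrow> complex \<Rightarrow> complex) topology"
  where "hol_seq_topology \<equiv> product_topology (\<lambda>_. hol_topology) UNIV"

definition dense_in :: "'a topology \<Rightarrow> 'a set \<Rightarrow> bool"
  where "dense_in X S \<longleftrightarrow> S \<subseteq> topspace X \<and> X closure_of S = topspace X"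

definition residual_in :: "'a topology \<Rightarrow> 'a set \<Rightarrow> bool"
  where "residual_in X S \<longleftrightarrow> S \<subseteq> topspace X \<and> (\<exists>G \<subseteq> S. gdelta_in X G \<and> dense_in X G)"

text \<open>A monomial maps the index of a variable to its exponent; a polynomial maps monomials to
  coefficients.\<close>

type_synonym mpoly = "(nat \<Rightarrow>\<^sub>0 nat) \<Rightarrow>\<^sub>0 complex"

definition mpoly_vars :: "mpoly \<Rightarrow> nat set"
  where "mpoly_vars P = (\<Union>m\<in>Poly_Mapping.keys P. Poly_Mapping.keys m)"

definition mpoly_eval :: "mpoly \<Rightarrow> (nat \<Rightarrow> complex) \<Rightarrow> complex"
  where "mpoly_eval P x = (\<Sum>m\<in>Poly_Mapping.keys P. Poly_Mapping.lookup P m *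
    (\<Prod>i\<in>Poly_Mapping.keys m. x i ^ Poly_Mapping.lookup m i))"

text \<open>The element \<open>P(b 0, b 1, \<dots>)\<close> of the algebra \<open>hol_disc\<close>, whose operations are pointwise.\<close>

definition hol_eval :: "mpoly \<Rightarrow> (nat \<Rightarrow> complex \<Rightarrow> complex) \<Rightarrow> complex \<Rightarrow> complex"
  where "hol_eval P b = (\<lambda>z\<in>disc. mpoly_eval P (\<lambda>i. b i z))"

definition generated_subalgebra :: "(complex \<Rightarrow> complex) set \<Rightarrow> (complex \<Rightarrow> complex) set"
  where "generated_subalgebra B =
    {hol_eval P b | P b n. mpoly_vars P \<subseteq> {..<n} \<and> (\<forall>i<n. b i \<in> B)}"

definition algebraically_independent :: "(complex \<Rightarrow> complex) set \<Rightarrow> bool"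
  where "algebraically_independent B \<longleftrightarrow>
    (\<forall>P b (n::nat). mpoly_vars P \<subseteq> {..<n} \<and> (\<forall>i<n. b i \<in> B) \<and> inj_on b {..<n} \<and>
        hol_eval P b = (\<lambda>z\<in>disc. 0) \<longrightarrow> P = 0)"

definition densely_strongly_algebrable :: "(complex \<Rightarrow> complex) set \<Rightarrow> bool"
  where "densely_strongly_algebrable A \<longleftrightarrow>
    (\<exists>B \<subseteq> hol_disc. infinite B \<and> algebraically_independent B \<and>
      dense_in hol_topology (generated_subalgebra B) \<and>
      generated_subalgebra B \<subseteq> A \<union> hol_constants)"

definition radius_sequence :: "(nat \<Rightarrow> real) \<Rightarrow> bool"
  where "radius_sequence r \<longleftrightarrow> incseq r \<and> range r \<subseteq> {0..<1} \<and> r \<longlonglongrightarrow> 1"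

definition abel_universal_along :: "(nat \<Rightarrow> real) \<Rightarrow> (complex \<Rightarrow> complex) set"
  where "abel_universal_along r = {f \<in> hol_disc.
    \<forall>K \<phi>. compact K \<and> K \<subset> circle \<and> continuous_on K \<phi> \<longrightarrow>
      (\<exists>n :: nat \<Rightarrow> nat. strict_mono n \<and>
        uniform_limit K (\<lambda>k \<zeta>. f (complex_of_real (r (n k)) * \<zeta>)) \<phi> sequentially)}"

definition abel_universal :: "(complex \<Rightarrow> complex) set"
  where "abel_universal = (\<Union>r \<in> Collect radius_sequence. abel_universal_along r)"

text \<open>A sequence freely generates a subalgebra if it is algebraically independent as a family,
  so repeated terms are excluded.\<close>

definition freely_generating :: "(nat \<Rightarrow> complex \<Rightarrow> complex) \<Rightarrow> bool"
  where "freely_generating f \<longleftrightarrow> inj f \<and> algebraically_independent (range f)"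

end

theory Submission
  imports Defs "HOL-Complex_Analysis.Complex_Analysis"
    "HOL-Computational_Algebra.Fundamental_Theorem_Algebra"
begin

text \<open>Call a sequence \<open>(f\<^sub>j)\<close> jointly universal if on every proper compact subset of the circle any
  finitely many of the \<open>f\<^sub>j\<close> approximate arbitrary continuous targets simultaneously, along the same
  radii. Joint universality forces algebraic independence (take constant targets), and it makes every
  nonconstant \<open>P(f\<^sub>1, \<dots>, f\<^sub>n)\<close> universal: restricted to a suitable complex line, \<open>P\<close> becomes a nonconstant
  polynomial in one variable, through which continuous functions on an arc lift up to a small error.

  Joint universality is a countable intersection of open conditions, because polynomials with
  coefficients in a countable dense set are uniformly dense in \<open>C(K)\<close>. Each condition is dense: given
  \<open>f\<close> and a target \<open>p\<close>, the function \<open>f + h (p - f)\<close> works as soon as \<open>h\<close> is close to \<open>0\<close> on a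
  disc and close to \<open>1\<close> on an arc outside it, and such \<open>h\<close> exist by pole pushing as in Runge's
  theorem. Density of the set of the \<open>f\<^sub>j\<close> itself is generic as well, and Baire's theorem concludes.\<close>

section \<open>Holomorphic approximation\<close>

text \<open>Properness of \<open>K\<close> is used three times, each time through a point
  \<open>\<omega>\<close> of the circle outside \<open>K\<close>: poles leave the disc through the
  gap at \<open>\<omega>\<close>; polynomials become dense in \<open>C(K)\<close>, whereas on the
  whole circle \<open>1/z\<close> is not a uniform limit of polynomials; and the circle cut at
  \<open>\<omega>\<close> is an interval, along which functions can be lifted. It also reduces the
  uncountably many sets \<open>K\<close> to countably many: each one lies in
  \<open>circle - U\<close> for some member \<open>U\<close> of a countable basis.

  Universality of the single functions would not pass to polynomials in them, since nothing would
  tie their radii together; hence the simultaneous condition. Lifting through a polynomial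
  \<open>q\<close> is only approximate, which is enough and avoids a continuous choice of roots near
  the critical values of \<open>q\<close>.\<close>

definition hol_approximable :: "complex set \<Rightarrow> complex set \<Rightarrow> (complex \<Rightarrow> complex) \<Rightarrow> bool"
  where "hol_approximable E \<Omega> f \<longleftrightarrow>
    (\<forall>\<epsilon>>0. \<exists>g. g holomorphic_on \<Omega> \<and> (\<forall>z\<in>E. dist (g z) (f z) < \<epsilon>))"

lemma hol_approximable_holomorphic: "f holomorphic_on \<Omega> \<Longrightarrow> hol_approximable E \<Omega> f"
  unfolding hol_approximable_def by (metis dist_self)

lemma hol_approximable_cong:
  assumes "hol_approximable E \<Omega> f" "\<And>z. z \<in> E \<Longrightarrow> f z = g z"
  shows "hol_approximable E \<Omega> g"
  using assms unfolding hol_approximable_def by metis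

lemma hol_approximable_closed:
  assumes "\<And>\<epsilon>. \<epsilon> > 0 \<Longrightarrow> \<exists>g. hol_approximable E \<Omega> g \<and> (\<forall>z\<in>E. dist (g z) (f z) < \<epsilon>)"
  shows "hol_approximable E \<Omega> f"
  unfolding hol_approximable_def
proof (intro allI impI)
  fix \<epsilon> :: real assume "\<epsilon> > 0"
  then obtain g where g: "hol_approximable E \<Omega> g" "\<forall>z\<in>E. dist (g z) (f z) < \<epsilon>/2"
    using assms half_gt_zero by blast
  then obtain h where "h holomorphic_on \<Omega>" "\<forall>z\<in>E. dist (h z) (g z) < \<epsilon>/2"
    using \<open>\<epsilon> > 0\<close> half_gt_zero unfolding hol_approximable_def by blast
  then show "\<exists>g. g holomorphic_on \<Omega> \<and> (\<forall>z\<in>E. dist (g z) (f z) < \<epsilon>)"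
    using g(2) by (metis dist_triangle_half_l dist_commute)
qed

lemma hol_approximable_add:
  assumes "hol_approximable E \<Omega> f" "hol_approximable E \<Omega> g"
  shows "hol_approximable E \<Omega> (\<lambda>z. f z + g z)"
  unfolding hol_approximable_def
proof (intro allI impI)
  fix \<epsilon> :: real assume "\<epsilon> > 0"
  then obtain f' g' where fg: "f' holomorphic_on \<Omega>" "\<forall>z\<in>E. dist (f' z) (f z) < \<epsilon>/2"
    "g' holomorphic_on \<Omega>" "\<forall>z\<in>E. dist (g' z) (g z) < \<epsilon>/2"
    using assms half_gt_zero unfolding hol_approximable_def by meson
  moreover have "dist (f' z + g' z) (f z + g z) < \<epsilon>" if "z \<in> E" for z
    using fg that by (intro dist_triangle_add_half) auto
  ultimately show "\<exists>h. h holomorphic_on \<Omega> \<and> (\<forall>z\<in>E. dist (h z) (f z + g z) < \<epsilon>)"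
    by (intro exI[of _ "\<lambda>z. f' z + g' z"]) (auto intro!: holomorphic_intros)
qed

lemma hol_approximable_bounded:
  assumes "compact E" "E \<subseteq> \<Omega>" "hol_approximable E \<Omega> f"
  obtains B where "B > 0" "\<And>z. z \<in> E \<Longrightarrow> norm (f z) \<le> B"
proof -
  obtain g where g: "g holomorphic_on \<Omega>" "\<forall>z\<in>E. dist (g z) (f z) < 1"
    using assms(3) unfolding hol_approximable_def by (meson zero_less_one)
  have "continuous_on E g"
    using g(1) assms(2) holomorphic_on_imp_continuous_on holomorphic_on_subset by blast
  then have "bounded (g ` E)"
    using assms(1) by (simp add: compact_continuous_image compact_imp_bounded)
  then obtain B where B: "B > 0" "\<forall>z\<in>E. norm (g z) \<le> B"
    unfolding bounded_pos by auto
  have "norm (f z) \<le> B + 1" if "z \<in> E" for z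
  proof -
    have "norm (f z) \<le> norm (g z) + norm (f z - g z)"
      by (metis add_diff_cancel_left' add_diff_eq norm_triangle_ineq)
    moreover have "norm (f z - g z) < 1" using g(2) that by (metis dist_norm norm_minus_commute)
    ultimately show ?thesis using B(2) that by fastforce
  qed
  then show ?thesis using that[of "B+1"] B(1) by auto
qed

lemma hol_approximable_mult:
  assumes "compact E" "E \<subseteq> \<Omega>" "hol_approximable E \<Omega> f" "hol_approximable E \<Omega> g"
  shows "hol_approximable E \<Omega> (\<lambda>z. f z * g z)"
  unfolding hol_approximable_def
proof (intro allI impI)
  fix \<epsilon> :: real assume \<epsilon>: "\<epsilon> > 0"
  obtain B where B: "B > 0" "\<And>z. z \<in> E \<Longrightarrow> norm (f z) \<le> B"
    by (rule hol_approximable_bounded[OF assms(1-3)]) blast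
  obtain C where C: "C > 0" "\<And>z. z \<in> E \<Longrightarrow> norm (g z) \<le> C"
    by (rule hol_approximable_bounded[OF assms(1,2,4)]) blast
  \<comment> \<open>The bound \<open>\<delta> \<le> 1\<close> lets the quadratic error
    \<open>a * b\<close> count as one more \<open>\<delta>\<close>, whence the summand 1 in
    \<open>B + C + 1\<close>.\<close>
  define \<delta> where "\<delta> = min 1 (\<epsilon> / (2 * (B + C + 1)))"
  have \<delta>: "\<delta> > 0" "\<delta> \<le> 1" "\<delta> * (B + C + 1) < \<epsilon>"
  proof -
    have "\<delta> * (B + C + 1) \<le> \<epsilon> / (2 * (B + C + 1)) * (B + C + 1)"
      using B C by (intro mult_right_mono) (auto simp: \<delta>_def)
    also have "\<dots> = \<epsilon>/2" using B C by (simp add: field_simps)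
    finally show "\<delta> * (B + C + 1) < \<epsilon>" using \<epsilon> by simp
  qed (use B C \<epsilon> in \<open>auto simp: \<delta>_def\<close>)
  obtain f' g' where fg: "f' holomorphic_on \<Omega>" "\<forall>z\<in>E. dist (f' z) (f z) < \<delta>"
    "g' holomorphic_on \<Omega>" "\<forall>z\<in>E. dist (g' z) (g z) < \<delta>"
    using assms \<delta> unfolding hol_approximable_def by meson
  have "dist (f' z * g' z) (f z * g z) < \<epsilon>" if "z \<in> E" for z
  proof -
    define a b where "a = f' z - f z" and "b = g' z - g z"
    have ab: "norm a < \<delta>" "norm b < \<delta>" using fg that by (auto simp: a_def b_def dist_norm)
    have "f' z * g' z - f z * g z = f z * b + g z * a + a * b"
      by (simp add: a_def b_def algebra_simps)
    then have "dist (f' z * g' z) (f z * g z) \<le> norm (f z) * norm b + norm (g z) * norm a + norm a * norm b"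
      unfolding dist_norm by (metis norm_mult norm_triangle_ineq norm_triangle_mono order_refl)
    also have "\<dots> \<le> B * \<delta> + C * \<delta> + \<delta> * 1"
      using B C ab \<delta> that by (intro add_mono mult_mono) (auto intro: less_imp_le)
    also have "\<dots> < \<epsilon>" using \<delta>(3) by (simp add: algebra_simps)
    finally show ?thesis .
  qed
  then show "\<exists>h. h holomorphic_on \<Omega> \<and> (\<forall>z\<in>E. dist (h z) (f z * g z) < \<epsilon>)"
    using fg by (intro exI[of _ "\<lambda>z. f' z * g' z"]) (auto intro!: holomorphic_intros)
qed

lemma hol_approximable_power:
  assumes "compact E" "E \<subseteq> \<Omega>" "hol_approximable E \<Omega> f"
  shows "hol_approximable E \<Omega> (\<lambda>z. f z ^ n)"
proof (induction n)
  case 0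
  then show ?case by (simp add: hol_approximable_holomorphic)
next
  case (Suc n)
  then show ?case using hol_approximable_mult[OF assms] by simp
qed

lemma hol_approximable_sum:
  assumes "\<And>i. i \<in> I \<Longrightarrow> hol_approximable E \<Omega> (f i)"
  shows "hol_approximable E \<Omega> (\<lambda>z. \<Sum>i\<in>I. f i z)"
  using assms
  by (induction I rule: infinite_finite_induct)
     (auto simp: hol_approximable_holomorphic intro: hol_approximable_add)

lemma hol_approximable_prod_mset:
  assumes "compact E" "E \<subseteq> \<Omega>" "\<And>i. i \<in># I \<Longrightarrow> hol_approximable E \<Omega> (f i)"
  shows "hol_approximable E \<Omega> (\<lambda>z. \<Prod>i\<in>#I. f i z)"
  using assms(3)
  by (induction I) (auto simp: hol_approximable_holomorphic intro: hol_approximable_mult[OF assms(1,2)])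

section \<open>Pole pushing, and gluing a disc to an arc outside it\<close>

text \<open>Expanding \<open>1/(z - y)\<close> as a geometric series in \<open>1/(z - x)\<close>.\<close>

lemma hol_approximable_move_pole:
  assumes E: "compact E" "E \<subseteq> \<Omega>" and x: "hol_approximable E \<Omega> (\<lambda>z. 1 / (z - x))"
    and q: "0 \<le> q" "q < 1" and d: "d > 0"
    and near: "\<And>z. z \<in> E \<Longrightarrow> dist y x \<le> q * dist z x"
    and far: "\<And>z. z \<in> E \<Longrightarrow> d \<le> dist z y" "\<And>z. z \<in> E \<Longrightarrow> z \<noteq> x"
  shows "hol_approximable E \<Omega> (\<lambda>z. 1 / (z - y))"
proof (rule hol_approximable_closed)
  fix \<epsilon> :: real assume \<epsilon>: "\<epsilon> > 0"
  obtain n where n: "q ^ n < \<epsilon> * d"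
    using real_arch_pow_inv[of "\<epsilon> * d" q] \<epsilon> d q by auto
  \<comment> \<open>With \<open>w = (y - x) / (z - x)\<close> the remainder of this partial sum is,
    up to sign, exactly \<open>w^n / (z - y)\<close>; \<open>q\<close> bounds \<open>w\<close>, and
    \<open>d\<close> keeps the denominator away from 0.\<close>
  define S where "S = (\<lambda>z. \<Sum>k<n. (y - x) ^ k * (1 / (z - x)) ^ Suc k)"
  have "hol_approximable E \<Omega> S"
    unfolding S_def
    by (intro hol_approximable_sum hol_approximable_mult hol_approximable_power E x
              hol_approximable_holomorphic holomorphic_intros)
  moreover have "dist (S z) (1 / (z - y)) < \<epsilon>" if z: "z \<in> E" for z
  proof -
    define w where "w = (y - x) / (z - x)"
    have nz: "z - x \<noteq> 0" "z - y \<noteq> 0" using far z d by force+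
    have w1: "1 - w = (z - y) / (z - x)" using nz by (simp add: w_def field_simps)
    have w: "norm w \<le> q"
      using near[OF z] nz by (simp add: w_def norm_divide dist_norm divide_le_eq norm_minus_commute)
    have "S z = (1 / (z - x)) * (\<Sum>k<n. w ^ k)"
      unfolding S_def sum_distrib_left w_def
      by (intro sum.cong) (auto simp: power_divide)
    also have "(\<Sum>k<n. w ^ k) = (1 - w ^ n) / (1 - w)"
      using w1 nz by (subst sum_gp_strict) auto
    also have "(1 / (z - x)) * \<dots> = (1 - w ^ n) / (z - y)"
      unfolding w1 using nz by simp
    finally have "S z - 1 / (z - y) = - (w ^ n / (z - y))"
      by (simp add: diff_divide_distrib)
    then have "dist (S z) (1 / (z - y)) = norm w ^ n / dist z y"
      by (simp add: dist_norm norm_divide norm_power)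
    also have "\<dots> \<le> q ^ n / d"
      using far(1)[OF z] w d q by (intro frac_le power_mono) auto
    also have "\<dots> < \<epsilon>" using n d by (simp add: divide_less_eq)
    finally show ?thesis .
  qed
  ultimately show "\<exists>g. hol_approximable E \<Omega> g \<and> (\<forall>z\<in>E. dist (g z) (1 / (z - y)) < \<epsilon>)" by blast
qed

text \<open>Connectedness of \<open>W\<close> replaces an explicit chain of discs: approximability
  spreads from one pole to all nearby ones, and it starts at \<open>p\<close>, where
  \<open>1/(z - p)\<close> is itself holomorphic on \<open>\<Omega>\<close>.\<close>

lemma hol_approximable_pole:
  assumes E: "compact E" "E \<subseteq> \<Omega>" and W: "connected W" "W \<inter> E = {}"
    and p: "p \<in> W" "p \<notin> \<Omega>" and y: "y \<in> W"
  shows "hol_approximable E \<Omega> (\<lambda>z. 1 / (z - y))"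
proof (rule connected_induction_simple[OF W(1) p(1) y])
  show "hol_approximable E \<Omega> (\<lambda>z. 1 / (z - p))"
    using p by (intro hol_approximable_holomorphic holomorphic_intros) auto
next
  fix a assume a: "a \<in> W"
  have "a \<notin> E" using W(2) a by auto
  then obtain d where d: "d > 0" "\<And>z. z \<in> E \<Longrightarrow> d \<le> dist a z"
    using separate_point_closed[of E a] E(1) compact_imp_closed by auto
  show "\<exists>T. openin (top_of_set W) T \<and> a \<in> T \<and> (\<forall>x\<in>T. \<forall>y\<in>T.
          hol_approximable E \<Omega> (\<lambda>z. 1 / (z - x)) \<longrightarrow> hol_approximable E \<Omega> (\<lambda>z. 1 / (z - y)))"
  proof (intro exI conjI ballI impI)
    \<comment> \<open>Points within \<open>d/4\<close> of \<open>a\<close> have distance at least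
      \<open>3/4 * d\<close> from \<open>E\<close> and at most \<open>d/2\<close> from each other;
      the quotient \<open>2/3\<close> is the ratio of the geometric series.\<close>
    show "openin (top_of_set W) (W \<inter> ball a (d/4))" by (simp add: openin_open_Int)
    show "a \<in> W \<inter> ball a (d/4)" using a d by simp
    fix x y assume x: "x \<in> W \<inter> ball a (d/4)" and y: "y \<in> W \<inter> ball a (d/4)"
      and hx: "hol_approximable E \<Omega> (\<lambda>z. 1 / (z - x))"
    have far: "3/4 * d \<le> dist z u" if "z \<in> E" "u \<in> ball a (d/4)" for z u
      using d(2)[OF that(1)] that(2) dist_triangle[of a z u] by (auto simp: dist_commute)
    have yx: "dist y x \<le> d/2" using x y dist_triangle[of y x a] by (auto simp: dist_commute)
    show "hol_approximable E \<Omega> (\<lambda>z. 1 / (z - y))"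
    proof (rule hol_approximable_move_pole[OF E hx])
      show "3/4 * d > 0" "0 \<le> (2/3::real)" "(2/3::real) < 1" using d by auto
      show "dist y x \<le> 2/3 * dist z x" "3/4 * d \<le> dist z y" "z \<noteq> x" if "z \<in> E" for z
        using far[OF that, of x] far[OF that, of y] x y yx W(2) that by auto
    qed
  qed
qed

text \<open>The reciprocal factors into simple poles, with multiplicities recorded by the multiset
  of roots, so moving simple poles is enough.\<close>

lemma hol_approximable_inverse_poly:
  assumes E: "compact E" "E \<subseteq> \<Omega>" and "p \<noteq> 0"
    and roots: "\<And>a. poly p a = 0 \<Longrightarrow> hol_approximable E \<Omega> (\<lambda>z. 1 / (z - a))"
  shows "hol_approximable E \<Omega> (\<lambda>z. 1 / poly p z)"
proof -
  obtain A where A: "p = smult (lead_coeff p) (\<Prod>x\<in>#A. [:- x, 1:])"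
    using alg_closed_imp_factorization[OF \<open>p \<noteq> 0\<close>] by blast
  have ev: "poly p z = lead_coeff p * (\<Prod>x\<in>#A. z - x)" for z
    by (subst A) (simp add: poly_prod_mset image_mset.compositionality o_def)
  have "poly p a = 0" if "a \<in># A" for a
    using that by (simp add: ev)
  then have "hol_approximable E \<Omega> (\<lambda>z. 1 / lead_coeff p * (\<Prod>x\<in>#A. 1 / (z - x)))"
    by (intro hol_approximable_mult hol_approximable_prod_mset E roots
          hol_approximable_holomorphic holomorphic_intros)
  moreover have "(\<Prod>x\<in>#A. 1 / (z - x)) = 1 / (\<Prod>x\<in>#A. z - x)" for z
    by (induction A) auto
  ultimately show ?thesis by (simp add: ev)
qed

text \<open>The function \<open>z^M / (z^M - s^M)\<close> with \<open>R < s < \<rho>\<close> has the required values; its poles, which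
  lie on \<open>|z| = s\<close>, are pushed out of the disc through the gap \<open>U\<close> of the circle.\<close>

lemma disc_circle_separation:
  fixes U :: "complex set"
  assumes R: "0 \<le> R" "R < \<rho>" "\<rho> < 1" and U: "open U" "circle \<inter> U \<noteq> {}" and \<eta>: "\<eta> > 0"
  obtains h where "h holomorphic_on disc" "\<And>z. z \<in> cball 0 R \<Longrightarrow> norm (h z) < \<eta>"
    "\<And>\<zeta>. \<zeta> \<in> circle - U \<Longrightarrow> norm (h (of_real \<rho> * \<zeta>) - 1) < \<eta>"
proof -
  obtain \<omega> where \<omega>: "\<omega> \<in> U" "norm \<omega> = 1" using U(2) by auto
  define s where "s = (R + \<rho>) / 2"
  have s: "R < s" "s < \<rho>" "0 < s" "s < 1" using R by (auto simp: s_def)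
  define E where "E = cball 0 R \<union> (\<lambda>\<zeta>. of_real \<rho> * \<zeta>) ` (circle - U)"
  have "compact ((\<lambda>\<zeta>. of_real \<rho> * \<zeta>) ` (circle - U))"
    by (intro compact_continuous_image continuous_intros compact_diff U) auto
  then have E: "compact E" by (auto simp: E_def)
  have Ed: "E \<subseteq> disc" using R by (auto simp: E_def norm_mult)
  \<comment> \<open>The circle carrying all the poles, joined to \<open>\<omega>\<close> on the
    boundary by a radial segment. The segment meets the circle of radius \<open>\<rho>\<close> only
    at \<open>\<rho> \<omega>\<close>, which is not in \<open>E\<close> because
    \<open>\<omega>\<close> lies in \<open>U\<close>.\<close>
  define W where "W = sphere 0 s \<union> closed_segment (of_real s * \<omega>) \<omega>"
  have seg: "\<exists>t. s \<le> t \<and> t \<le> 1 \<and> z = of_real t * \<omega>" if z: "z \<in> closed_segment (of_real s * \<omega>) \<omega>" for z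
  proof -
    obtain u where u: "0 \<le> u" "u \<le> 1" "z = (1 - u) *\<^sub>R (of_real s * \<omega>) + u *\<^sub>R \<omega>"
      using z by (auto simp: in_segment)
    have "0 \<le> u * (1 - s)" "0 \<le> (1 - u) * (1 - s)" using u s by auto
    then show ?thesis using u
      by (intro exI[of _ "(1 - u) * s + u"]) (auto simp: scaleR_conv_of_real algebra_simps)
  qed
  have W: "connected W"
    unfolding W_def
  proof (rule connected_Un)
    have "of_real s * \<omega> \<in> sphere 0 s \<inter> closed_segment (of_real s * \<omega>) \<omega>"
      using s \<omega> by (simp add: norm_mult)
    then show "sphere 0 s \<inter> closed_segment (of_real s * \<omega>) \<omega> \<noteq> {}" by blast
  qed (use connected_sphere[of "0::complex" s] in auto)
  have WE: "W \<inter> E = {}"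
  proof -
    have "z \<notin> E" if zW: "z \<in> W" for z
    proof
      assume zE: "z \<in> E"
      from zW have alt: "norm z = s \<or> (\<exists>t. s \<le> t \<and> t \<le> 1 \<and> z = of_real t * \<omega>)"
        using seg by (auto simp: W_def)
      then have "norm z \<ge> s"
        using \<omega> s by (auto simp: norm_mult)
      with zE s obtain \<zeta> where \<zeta>: "\<zeta> \<in> circle - U" "z = of_real \<rho> * \<zeta>" by (auto simp: E_def)
      then have nz: "norm z = \<rho>" using R by (auto simp: norm_mult)
      with alt s obtain t where t: "s \<le> t" "z = of_real t * \<omega>" by auto
      with nz \<omega> s have "t = \<rho>" by (auto simp: norm_mult)
      with t \<zeta> s have "\<zeta> = \<omega>" by auto
      with \<zeta> \<omega> show False by auto
    qed
    then show ?thesis by blast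
  qed
  have pole: "hol_approximable E disc (\<lambda>z. 1 / (z - y))" if "norm y = s" for y
    by (rule hol_approximable_pole[OF E Ed W WE, of \<omega>]) (use that \<omega> in \<open>auto simp: W_def\<close>)
  \<comment> \<open>Both errors below have the form \<open>x / (1 - x)\<close> with
    \<open>x < \<delta>\<close>. Since \<open>\<delta> \<le> 1/2\<close> they are at most
    \<open>2 \<delta> \<le> \<eta>/2\<close>; the other half of \<open>\<eta>\<close> pays for
    replacing the quotient by \<open>h\<close>.\<close>
  define \<delta> where "\<delta> = min (1/2) (\<eta>/4)"
  have \<delta>: "\<delta> > 0" "\<delta> \<le> 1/2" "\<delta> \<le> \<eta>/4" using \<eta> by (auto simp: \<delta>_def)
  obtain m1 where m1: "(R / s) ^ m1 < \<delta>" using real_arch_pow_inv[of \<delta> "R/s"] \<delta> s by auto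
  obtain m2 where m2: "(s / \<rho>) ^ m2 < \<delta>" using real_arch_pow_inv[of \<delta> "s/\<rho>"] \<delta> s by auto
  \<comment> \<open>The exponent dominates \<open>m1\<close> and \<open>m2\<close>, and the summand
    1 keeps it positive: for exponent 0 the polynomial \<open>p\<close> would vanish
    identically.\<close>
  define M where "M = m1 + m2 + 1"
  have x1: "(R / s) ^ M < \<delta>"
    using m1 R s power_decreasing[of m1 M "R/s"] by (simp add: M_def)
  have x2: "(s / \<rho>) ^ M < \<delta>"
    using m2 R s power_decreasing[of m2 M "s/\<rho>"] by (simp add: M_def)
  define p :: "complex poly" where "p = monom 1 M - [:of_real s ^ M:]"
  have p: "poly p z = z ^ M - of_real s ^ M" for z by (simp add: p_def poly_monom)
  have inv: "hol_approximable E disc (\<lambda>z. 1 / poly p z)"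
  proof (rule hol_approximable_inverse_poly[OF E Ed])
    show "p \<noteq> 0"
    proof
      assume "p = 0"
      then have "poly p 0 = 0" by simp
      then show False using s by (simp add: p M_def)
    qed
    fix a assume "poly p a = 0"
    then have "norm a ^ M = s ^ M" using s by (simp add: p flip: norm_power) (simp add: norm_power)
    then have "norm a = s" using s by (intro power_eq_imp_eq_base[of "norm a" M s]) (auto simp: M_def)
    then show "hol_approximable E disc (\<lambda>z. 1 / (z - a))" by (rule pole)
  qed
  have "hol_approximable E disc (\<lambda>z. z ^ M * (1 / poly p z))"
    by (rule hol_approximable_mult[OF E Ed hol_approximable_holomorphic[of "\<lambda>z. z ^ M"] inv])
       (intro holomorphic_intros)
  then obtain h where h: "h holomorphic_on disc"
      "\<And>z. z \<in> E \<Longrightarrow> dist (h z) (z ^ M / poly p z) < \<eta>/2"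
    unfolding hol_approximable_def times_divide_eq_right mult_1_right
    using half_gt_zero[OF \<eta>] by blast
  show thesis
  proof (rule that[OF h(1)])
    fix z :: complex assume z: "z \<in> cball 0 R"
    define x where "x = norm z ^ M / s ^ M"
    have "x \<le> (R/s) ^ M" using z s by (auto simp: x_def power_divide intro!: divide_right_mono power_mono)
    then have x: "0 \<le> x" "x < \<delta>" using x1 s by (auto simp: x_def)
    have "norm (poly p z) \<ge> s ^ M - norm z ^ M"
      using norm_triangle_ineq2[of "of_real s ^ M" "z ^ M"] s by (simp add: p norm_power norm_minus_commute)
    also have "s ^ M - norm z ^ M = s ^ M * (1 - x)" using s by (simp add: x_def field_simps)
    finally have "norm (poly p z) \<ge> s ^ M * (1 - x)" .
    then have "norm (z ^ M / poly p z) \<le> norm z ^ M / (s ^ M * (1 - x))"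
      unfolding norm_divide norm_power using x \<delta> s by (intro frac_le) auto
    also have "\<dots> = x / (1 - x)" by (simp add: x_def)
    also have "\<dots> \<le> \<delta> / (1/2)" using x \<delta> by (intro frac_le) auto
    also have "\<dots> \<le> \<eta>/2" using \<delta> by simp
    finally have "norm (z ^ M / poly p z) \<le> \<eta>/2" .
    moreover have "dist (h z) (z ^ M / poly p z) < \<eta>/2" using h(2) z by (simp add: E_def)
    ultimately show "norm (h z) < \<eta>"
      using norm_triangle_ineq2[of "h z" "z ^ M / poly p z"] by (simp add: dist_norm)
  next
    fix \<zeta> :: complex assume \<zeta>: "\<zeta> \<in> circle - U"
    define z where "z = of_real \<rho> * \<zeta>"
    have nz: "norm z = \<rho>" using \<zeta> R by (auto simp: z_def norm_mult)
    define x where "x = s ^ M / \<rho> ^ M"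
    have x: "0 \<le> x" "x < \<delta>" using x2 s by (auto simp: x_def power_divide)
    have "norm (poly p z) \<ge> \<rho> ^ M - s ^ M"
      using norm_triangle_ineq2[of "z ^ M" "of_real s ^ M"] s nz by (simp add: p norm_power)
    also have "\<rho> ^ M - s ^ M = \<rho> ^ M * (1 - x)" using s by (simp add: x_def field_simps)
    finally have lower: "norm (poly p z) \<ge> \<rho> ^ M * (1 - x)" .
    have "0 < \<rho> ^ M * (1 - x)" using x \<delta> s by (auto intro!: mult_pos_pos)
    then have "poly p z \<noteq> 0" using lower by auto
    then have "z ^ M / poly p z - 1 = of_real s ^ M / poly p z" by (simp add: p field_simps)
    then have "norm (z ^ M / poly p z - 1) = s ^ M / norm (poly p z)"
      using s by (simp add: norm_divide norm_power)
    also have "\<dots> \<le> s ^ M / (\<rho> ^ M * (1 - x))"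
      using lower x \<delta> s by (intro frac_le) auto
    also have "\<dots> = x / (1 - x)" by (simp add: x_def)
    also have "\<dots> \<le> \<delta> / (1/2)" using x \<delta> by (intro frac_le) auto
    also have "\<dots> \<le> \<eta>/2" using \<delta> by simp
    finally have "norm (z ^ M / poly p z - 1) \<le> \<eta>/2" .
    moreover have "z \<in> E" using \<zeta> unfolding E_def z_def by blast
    then have "dist (h z) (z ^ M / poly p z) < \<eta>/2" by (rule h(2))
    ultimately have "norm (h z - 1) < \<eta>"
      using norm_triangle_ineq[of "h z - z ^ M / poly p z" "z ^ M / poly p z - 1"] by (simp add: dist_norm)
    then show "norm (h (of_real \<rho> * \<zeta>) - 1) < \<eta>" by (simp add: z_def)
  qed
qed

lemma disc_circle_fusion:
  fixes U :: "complex set"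
  assumes R: "0 \<le> R" "R < \<rho>" "\<rho> < 1" and U: "open U" "circle \<inter> U \<noteq> {}" and \<epsilon>: "\<epsilon> > 0"
    and f: "f holomorphic_on disc" and p: "p holomorphic_on UNIV"
  obtains g where "g holomorphic_on disc" "\<And>z. z \<in> cball 0 R \<Longrightarrow> dist (g z) (f z) < \<epsilon>"
    "\<And>\<zeta>. \<zeta> \<in> circle - U \<Longrightarrow> dist (g (of_real \<rho> * \<zeta>)) (p \<zeta>) < \<epsilon>"
proof -
  \<comment> \<open>Dividing by \<open>\<rho>\<close> makes the value \<open>p \<zeta>\<close>
    appear at the point \<open>\<rho> \<zeta>\<close>. For \<open>z\<close> in the disc
    \<open>z / \<rho>\<close> may leave the disc, so \<open>p\<close> is taken entire.\<close>
  define P where "P = (\<lambda>z. p (z / of_real \<rho>) - f z)"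
  have P: "P holomorphic_on disc"
    unfolding P_def using R
    by (intro holomorphic_intros f holomorphic_on_compose_gen[OF _ p, unfolded o_def]) auto
  have "continuous_on (cball 0 \<rho>) P"
    using R by (intro holomorphic_on_imp_continuous_on holomorphic_on_subset[OF P]) auto
  then have "bounded (P ` cball 0 \<rho>)"
    by (simp add: compact_continuous_image compact_imp_bounded)
  then obtain B where B: "B > 0" "\<And>z. z \<in> cball 0 \<rho> \<Longrightarrow> norm (P z) \<le> B"
    unfolding bounded_pos by auto
  obtain h where h: "h holomorphic_on disc" "\<And>z. z \<in> cball 0 R \<Longrightarrow> norm (h z) < \<epsilon> / B"
    "\<And>\<zeta>. \<zeta> \<in> circle - U \<Longrightarrow> norm (h (of_real \<rho> * \<zeta>) - 1) < \<epsilon> / B"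
    using disc_circle_separation[OF R U, of "\<epsilon>/B"] \<epsilon> B by auto
  have small: "norm (a * P z) < \<epsilon>" if "norm a < \<epsilon> / B" "z \<in> cball 0 \<rho>" for a z
  proof -
    have "norm (a * P z) \<le> norm a * B" unfolding norm_mult using B that by (intro mult_left_mono) auto
    also have "\<dots> < \<epsilon>" using that B by (simp add: field_simps)
    finally show ?thesis .
  qed
  show thesis
  proof (rule that)
    show "(\<lambda>z. f z + h z * P z) holomorphic_on disc" by (intro holomorphic_intros f h P)
    show "dist (f z + h z * P z) (f z) < \<epsilon>" if "z \<in> cball 0 R" for z
      using small[OF h(2)[OF that], of z] that R by (simp add: dist_norm)
    fix \<zeta> :: complex assume \<zeta>: "\<zeta> \<in> circle - U"
    let ?z = "of_real \<rho> * \<zeta>"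
    have "f ?z + h ?z * P ?z - p \<zeta> = (h ?z - 1) * P ?z"
      using R by (simp add: P_def algebra_simps)
    then show "dist (f ?z + h ?z * P ?z) (p \<zeta>) < \<epsilon>"
      using small[OF h(3)[OF \<zeta>], of ?z] \<zeta> R by (simp add: dist_norm norm_mult)
  qed
qed

section \<open>Polynomial approximation on discs and on proper compact subsets of the circle\<close>

text \<open>Taylor partial sums at 0: convergence at the intermediate radius \<open>s\<close> puts
  \<open>cball 0 R\<close> strictly inside the disc of convergence, where it is uniform.\<close>

lemma holomorphic_approx_poly:
  assumes f: "f holomorphic_on ball 0 \<rho>" and R: "R < \<rho>" and \<epsilon>: "\<epsilon> > 0"
  obtains p where "\<And>z. z \<in> cball 0 R \<Longrightarrow> dist (poly p z) (f z) < \<epsilon>"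
proof -
  define s where "s = (max R 0 + \<rho>) / 2"
  define a where "a = (\<lambda>n. (deriv ^^ n) f 0 / fact n)"
  show thesis
  proof (cases "R < 0")
    case True
    then show ?thesis using that by auto
  next
    case False
    then have s: "R < s" "s < \<rho>" "0 < s" using R by (auto simp: s_def)
    have sums: "(\<lambda>n. a n * z ^ n) sums f z" if "norm z < \<rho>" for z
      using holomorphic_power_series[OF f, of z] that by (simp add: a_def)
    have "summable (\<lambda>n. a n * of_real s ^ n)"
      using sums[of "of_real s"] s by (auto simp: sums_iff)
    then have "ereal (norm (of_real s :: complex)) \<le> conv_radius a"
      using conv_radius_geI by blast
    then have "ereal R < conv_radius a"
      using s by (smt (verit, best) less_ereal.simps(1) norm_of_real order_less_le_trans)
    then have "uniform_limit (cball 0 R) (\<lambda>n z. \<Sum>i<n. a i * (z - 0) ^ i)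
        (\<lambda>z. suminf (\<lambda>i. a i * (z - 0) ^ i)) sequentially"
      by (rule powser_uniform_limit)
    then have "\<forall>\<^sub>F n in sequentially. \<forall>z\<in>cball 0 R.
        dist (\<Sum>i<n. a i * (z - 0) ^ i) (suminf (\<lambda>i. a i * (z - 0) ^ i)) < \<epsilon>"
      using \<epsilon> by (rule uniform_limitD)
    then obtain n where n: "\<forall>z\<in>cball 0 R.
        dist (\<Sum>i<n. a i * (z - 0) ^ i) (suminf (\<lambda>i. a i * (z - 0) ^ i)) < \<epsilon>"
      using eventually_happens'[OF sequentially_bot] by blast
    show ?thesis
    proof (rule that[of "\<Sum>i<n. monom (a i) i"])
      fix z :: complex assume z: "z \<in> cball 0 R"
      have "suminf (\<lambda>i. a i * z ^ i) = f z" using sums[of z] z R by (simp add: sums_iff)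
      then show "dist (poly (\<Sum>i<n. monom (a i) i) z) (f z) < \<epsilon>"
        using bspec[OF n z] by (simp add: poly_sum poly_monom)
    qed
  qed
qed

text \<open>On the circle \<open>cnj z = 1/z\<close>, so the real polynomials of Stone-Weierstrass
  are polynomials in \<open>z\<close> and \<open>1/z\<close>. The pole at 0 can be pushed out
  through the point missing from \<open>K\<close>, and what remains is holomorphic on
  \<open>ball 0 2\<close>, hence close to a polynomial on the closed unit disc.\<close>

lemma continuous_circle_approx_poly:
  assumes K: "compact K" "K \<subset> circle" and \<phi>: "continuous_on K \<phi>" and \<epsilon>: "\<epsilon> > 0"
  obtains p where "\<And>z. z \<in> K \<Longrightarrow> dist (poly p z) (\<phi> z) < \<epsilon>"
proof -
  have sub: "K \<subseteq> ball 0 2" using K by auto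
  obtain \<omega> where \<omega>: "norm \<omega> = 1" "\<omega> \<notin> K" using psubset_imp_ex_mem[OF K(2)] by auto
  have inv: "hol_approximable K (ball 0 2) (\<lambda>z. 1 / (z - 0))"
  \<comment> \<open>The segment crosses the unit circle only at \<open>\<omega>\<close>, and its end
    \<open>2 * \<omega>\<close> lies outside the open ball of radius 2.\<close>
  proof (rule hol_approximable_pole[OF K(1) sub, of "closed_segment 0 (2 * \<omega>)" "2 * \<omega>"])
    show "closed_segment 0 (2 * \<omega>) \<inter> K = {}"
    proof -
      have "z \<notin> K" if "z \<in> closed_segment 0 (2 * \<omega>)" for z
      proof
        assume "z \<in> K"
        obtain u where u: "0 \<le> u" "z = u *\<^sub>R (2 * \<omega>)" using \<open>z \<in> closed_segment _ _\<close> by (auto simp: in_segment)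
        then have "norm z = 2 * u" using \<omega> by (simp add: norm_mult)
        then have "u = 1/2" using \<open>z \<in> K\<close> K by auto
        then have "z = \<omega>" using u(2) unfolding \<open>u = 1/2\<close> by (simp add: scaleR_conv_of_real)
        then show False using \<open>z \<in> K\<close> \<omega> by auto
      qed
      then show ?thesis by blast
    qed
  qed (use \<omega> in \<open>auto simp: norm_mult\<close>)
  have re: "hol_approximable K (ball 0 2) (\<lambda>z. of_real (p z))" if "real_polynomial_function p" for p
    using that
  proof induction
    case (linear f)
    \<comment> \<open>A real linear form is \<open>f 1 * Re z + f \<i> * Im z\<close>; for
      \<open>z\<close> in \<open>K\<close> the two factors are \<open>Re z = (z + 1/z)/2\<close> and
      \<open>Im z = (z - 1/z) * (-\<i>/2)\<close>.\<close>
    have "hol_approximable K (ball 0 2) (\<lambda>z. of_real (f 1) * ((z + 1 / (z - 0)) * (1/2)) +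
        of_real (f \<i>) * ((z + (- 1) * (1 / (z - 0))) * (- \<i>/2)))"
      by (intro hol_approximable_add hol_approximable_mult K sub inv
            hol_approximable_holomorphic holomorphic_intros)
    then show ?case
    proof (rule hol_approximable_cong)
      fix z assume z: "z \<in> K"
      then have nz: "norm z = 1" using K by auto
      have "1 / z = cnj z" using nz by (metis complex_div_cnj complex_cnj_one div_by_1 mult_1 of_real_1 power_one)
      moreover have "f z = Re z * f 1 + Im z * f \<i>"
      proof -
        have "z = Re z *\<^sub>R 1 + Im z *\<^sub>R \<i>" by (simp add: complex_eq_iff)
        then have "f z = f (Re z *\<^sub>R 1 + Im z *\<^sub>R \<i>)" by simp
        also have "\<dots> = Re z * f 1 + Im z * f \<i>"
          using linear by (simp add: linear_add linear_scale bounded_linear.linear)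
        finally show ?thesis .
      qed
      ultimately show "of_real (f 1) * ((z + 1 / (z - 0)) * (1/2)) +
          of_real (f \<i>) * ((z + (- 1) * (1 / (z - 0))) * (- \<i>/2)) = of_real (f z)"
        by (simp add: complex_eq_iff)
    qed
  qed (auto simp: hol_approximable_holomorphic intro: hol_approximable_add hol_approximable_mult[OF K(1) sub])
  have "hol_approximable K (ball 0 2) \<phi>"
  proof (rule hol_approximable_closed)
    fix \<epsilon> :: real assume "\<epsilon> > 0"
    then obtain g where g: "polynomial_function g" "\<forall>z\<in>K. norm (\<phi> z - g z) < \<epsilon>"
      using Stone_Weierstrass_polynomial_function[OF K(1) \<phi>] by blast
    have "real_polynomial_function (Re \<circ> g)" "real_polynomial_function (Im \<circ> g)"
      using g(1) bounded_linear_Re bounded_linear_Im unfolding polynomial_function_def by auto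
    then have "hol_approximable K (ball 0 2) (\<lambda>z. of_real ((Re \<circ> g) z) + \<i> * of_real ((Im \<circ> g) z))"
      by (intro hol_approximable_add hol_approximable_mult K sub re
            hol_approximable_holomorphic holomorphic_intros)
    also have "(\<lambda>z. of_real ((Re \<circ> g) z) + \<i> * of_real ((Im \<circ> g) z)) = g"
      by (auto simp: complex_eq_iff)
    finally show "\<exists>g. hol_approximable K (ball 0 2) g \<and> (\<forall>z\<in>K. dist (g z) (\<phi> z) < \<epsilon>)"
      using g(2) by (metis dist_norm norm_minus_commute)
  qed
  then obtain g where g: "g holomorphic_on ball 0 2" "\<forall>z\<in>K. dist (g z) (\<phi> z) < \<epsilon>/2"
    using \<epsilon> half_gt_zero unfolding hol_approximable_def by blast
  obtain p where p: "\<And>z. z \<in> cball 0 1 \<Longrightarrow> dist (poly p z) (g z) < \<epsilon>/2"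
    using holomorphic_approx_poly[OF g(1), of 1 "\<epsilon>/2"] \<epsilon> by auto
  have "dist (poly p z) (\<phi> z) < \<epsilon>" if "z \<in> K" for z
  proof -
    have "dist (g z) (poly p z) < \<epsilon>/2" using p[of z] that K(2) by (auto simp: dist_commute)
    then show ?thesis using bspec[OF g(2) that] by (rule dist_triangle_half_r)
  qed
  then show thesis using that by blast
qed

text \<open>This makes the set of targets countable. In Horner form the error of the tail is
  multiplied by \<open>z\<close>, which is at most \<open>B\<close> on \<open>E\<close>; hence the
  tolerance \<open>\<epsilon> / 2 / B\<close> for the tail.\<close>

lemma poly_approx_dense_coeffs:
  fixes D :: "complex set"
  assumes D: "\<And>U. open U \<Longrightarrow> U \<noteq> {} \<Longrightarrow> \<exists>d\<in>D. d \<in> U" and E: "bounded E" and \<epsilon>: "\<epsilon> > 0"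
  shows "\<exists>cs\<in>lists D. \<forall>z\<in>E. dist (poly (Poly cs) z) (poly p z) < \<epsilon>"
  using \<epsilon>
proof (induction p arbitrary: \<epsilon>)
  case 0
  then show ?case by (intro bexI[of _ "[]"]) auto
next
  case (pCons a p)
  obtain B where B: "B > 0" "\<And>z. z \<in> E \<Longrightarrow> norm z \<le> B" using E by (auto simp: bounded_pos)
  obtain cs where cs: "cs \<in> lists D" "\<forall>z\<in>E. dist (poly (Poly cs) z) (poly p z) < \<epsilon> / 2 / B"
    using pCons.IH[of "\<epsilon> / 2 / B"] pCons.prems B by auto
  obtain c where c: "c \<in> D" "dist c a < \<epsilon>/2"
    using D[of "ball a (\<epsilon>/2)"] pCons.prems by (auto simp: dist_commute)
  have "dist (poly (Poly (c # cs)) z) (poly (pCons a p) z) < \<epsilon>" if z: "z \<in> E" for z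
  proof -
    have "dist (z * poly (Poly cs) z) (z * poly p z) = norm z * dist (poly (Poly cs) z) (poly p z)"
      unfolding dist_norm by (simp add: norm_mult flip: right_diff_distrib)
    also have "\<dots> \<le> B * dist (poly (Poly cs) z) (poly p z)"
      using B z by (intro mult_right_mono) auto
    also have "\<dots> < \<epsilon>/2" using cs(2) z B by (simp add: field_simps)
    finally show ?thesis using c by (auto intro: dist_triangle_add_half)
  qed
  then show ?case using c cs(1) by (intro bexI[of _ "c # cs"]) auto
qed

section \<open>Baire category in the space of sequences\<close>

definition radius_gap :: "nat \<Rightarrow> real"
  where "radius_gap k = inverse (real (Suc k))"

definition disc_exhaustion :: "nat \<Rightarrow> complex set"
  where "disc_exhaustion k = cball 0 (1 - radius_gap k)"

lemma radius_gap_pos: "0 < radius_gap k"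
  by (simp add: radius_gap_def)

lemma radius_gap_antimono: "k \<le> m \<Longrightarrow> radius_gap m \<le> radius_gap k"
  by (simp add: radius_gap_def)

lemma radius_gap_Suc_less: "radius_gap (Suc k) < radius_gap k"
  by (simp add: radius_gap_def)

lemma radius_gap_arch: "e > 0 \<Longrightarrow> \<exists>k. radius_gap k < e"
  using reals_Archimedean by (auto simp: radius_gap_def)

lemma disc_exhaustion_mono: "k \<le> m \<Longrightarrow> disc_exhaustion k \<subseteq> disc_exhaustion m"
  using radius_gap_antimono[of k m] by (auto simp: disc_exhaustion_def)

lemma disc_exhaustion_subset: "disc_exhaustion k \<subseteq> disc"
  using radius_gap_pos[of k] by (auto simp: disc_exhaustion_def)

lemma compact_disc_exhaustion: "compact (disc_exhaustion k)"
  by (simp add: disc_exhaustion_def)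

lemma compact_subset_disc:
  assumes "compact K" "K \<subseteq> disc"
  obtains k where "K \<subseteq> disc_exhaustion k"
proof (cases "K = {}")
  case True
  then show ?thesis using that by auto
next
  case False
  obtain x where x: "x \<in> K" "\<And>y. y \<in> K \<Longrightarrow> norm y \<le> norm x"
    using continuous_attains_sup[OF assms(1) False, of norm] continuous_on_norm_id by blast
  then have "0 < 1 - norm x" using assms by auto
  then obtain k where "radius_gap k < 1 - norm x" using radius_gap_arch by blast
  then have "K \<subseteq> disc_exhaustion k" using x by (fastforce simp: disc_exhaustion_def)
  then show ?thesis by (rule that)
qed

lemma openin_hol_topology_nbhd:
  assumes "openin hol_topology T" "g \<in> T"
  obtains k where "{h \<in> hol_disc. \<forall>z\<in>disc_exhaustion k. dist (h z) (g z) < radius_gap k} \<subseteq> T"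
proof -
  obtain K e where K: "compact K" "K \<subseteq> disc" "e > 0" "hol_nbhd g K e \<subseteq> T"
    using assms unfolding openin_hol_topology hol_open_def by blast
  obtain k1 where k1: "K \<subseteq> disc_exhaustion k1"
    using compact_subset_disc[OF K(1,2)] .
  obtain k2 where k2: "radius_gap k2 < e" using K(3) radius_gap_arch by blast
  have 1: "K \<subseteq> disc_exhaustion (max k1 k2)"
    using k1 disc_exhaustion_mono[of k1 "max k1 k2"] by auto
  have 2: "radius_gap (max k1 k2) < e"
    using k2 radius_gap_antimono[of k2 "max k1 k2"] by linarith
  have "{h \<in> hol_disc. \<forall>z\<in>disc_exhaustion (max k1 k2). dist (h z) (g z) < radius_gap (max k1 k2)}
      \<subseteq> hol_nbhd g K e"
    using 1 2 unfolding hol_nbhd_def by (blast intro: less_trans)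
  from this K(4) show thesis using that by (meson subset_trans)
qed

text \<open>By compactness of \<open>L\<close> the distance to \<open>p\<close> attains its maximum,
  so the strict inequality leaves a uniform margin \<open>d\<close>.\<close>

lemma openin_hol_topology_ball:
  assumes L: "compact L" "L \<subseteq> disc" and p: "continuous_on L p"
  shows "openin hol_topology {g \<in> hol_disc. \<forall>z\<in>L. dist (g z) (p z) < e}"
  unfolding openin_hol_topology hol_open_def
proof (intro conjI ballI)
  fix g assume g: "g \<in> {g \<in> hol_disc. \<forall>z\<in>L. dist (g z) (p z) < e}"
  show "\<exists>K d. compact K \<and> K \<subseteq> disc \<and> d > 0 \<and> hol_nbhd g K d \<subseteq> {g \<in> hol_disc. \<forall>z\<in>L. dist (g z) (p z) < e}"
  proof (cases "L = {}")
    case True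
    then show ?thesis by (intro exI[of _ "{}"] exI[of _ 1]) (auto simp: hol_nbhd_def)
  next
    case False
    have "continuous_on L g"
      using g L by (auto simp: hol_disc_def intro: holomorphic_on_imp_continuous_on holomorphic_on_subset)
    then have "continuous_on L (\<lambda>z. dist (g z) (p z))"
      using p by (intro continuous_intros)
    then obtain x where x: "x \<in> L" "\<And>y. y \<in> L \<Longrightarrow> dist (g y) (p y) \<le> dist (g x) (p x)"
      using continuous_attains_sup[OF L(1) False] by blast
    define d where "d = e - dist (g x) (p x)"
    have "d > 0" using g x by (auto simp: d_def)
    moreover have "hol_nbhd g L d \<subseteq> {g \<in> hol_disc. \<forall>z\<in>L. dist (g z) (p z) < e}"
    proof
      fix h assume h: "h \<in> hol_nbhd g L d"
      have "dist (h z) (p z) < e" if "z \<in> L" for z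
        using h that x(2)[OF that] dist_triangle[of "h z" "p z" "g z"] by (force simp: hol_nbhd_def d_def)
      then show "h \<in> {g \<in> hol_disc. \<forall>z\<in>L. dist (g z) (p z) < e}" using h by (auto simp: hol_nbhd_def)
    qed
    ultimately show ?thesis using L by blast
  qed
qed auto

lemma topspace_hol_seq_topology: "topspace hol_seq_topology = {F. \<forall>j. F j \<in> hol_disc}"
  by (auto simp: topspace_hol_topology PiE_def Pi_def)

lemma openin_hol_seq_topology_ball:
  assumes L: "compact L" "L \<subseteq> disc" and p: "continuous_on L p"
  shows "openin hol_seq_topology {F. (\<forall>j. F j \<in> hol_disc) \<and> (\<forall>z\<in>L. dist (F i z) (p z) < e)}"
proof -
  have "openin hol_seq_topology {F \<in> topspace hol_seq_topology. F i \<in> {g \<in> hol_disc. \<forall>z\<in>L. dist (g z) (p z) < e}}"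
    by (rule openin_continuous_map_preimage[OF _ openin_hol_topology_ball[OF assms]])
       (auto intro: continuous_map_product_projection)
  also have "{F \<in> topspace hol_seq_topology. F i \<in> {g \<in> hol_disc. \<forall>z\<in>L. dist (g z) (p z) < e}}
      = {F. (\<forall>j. F j \<in> hol_disc) \<and> (\<forall>z\<in>L. dist (F i z) (p z) < e)}"
    unfolding topspace_hol_seq_topology by auto
  finally show ?thesis .
qed

lemma openin_hol_seq_topology_balls:
  fixes N :: nat
  assumes L: "compact L" "L \<subseteq> disc" and p: "\<And>j. j < N \<Longrightarrow> continuous_on L (p j)"
  shows "openin hol_seq_topology {F. (\<forall>j. F j \<in> hol_disc) \<and> (\<forall>j<N. \<forall>z\<in>L. dist (F j z) (p j z) < e)}"
  using p
proof (induction N)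
  case 0
  then show ?case
    using openin_topspace[of hol_seq_topology] unfolding topspace_hol_seq_topology by simp
next
  case (Suc N)
  have "openin hol_seq_topology
    ({F. (\<forall>j. F j \<in> hol_disc) \<and> (\<forall>j<N. \<forall>z\<in>L. dist (F j z) (p j z) < e)} \<inter>
     {F. (\<forall>j. F j \<in> hol_disc) \<and> (\<forall>z\<in>L. dist (F N z) (p N z) < e)})"
    by (intro openin_Int Suc.IH openin_hol_seq_topology_ball L Suc.prems) auto
  also have "{F. (\<forall>j. F j \<in> hol_disc) \<and> (\<forall>j<N. \<forall>z\<in>L. dist (F j z) (p j z) < e)} \<inter>
     {F. (\<forall>j. F j \<in> hol_disc) \<and> (\<forall>z\<in>L. dist (F N z) (p N z) < e)} =
     {F. (\<forall>j. F j \<in> hol_disc) \<and> (\<forall>j<Suc N. \<forall>z\<in>L. dist (F j z) (p j z) < e)}"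
    by (auto simp: less_Suc_eq)
  finally show ?case .
qed

text \<open>One index bounds the number of coordinates, the disc and the tolerance, so these sets
  decrease in \<open>k\<close> and form a countable neighbourhood base at \<open>F\<close>.\<close>

definition seq_nbhd :: "(nat \<Rightarrow> complex \<Rightarrow> complex) \<Rightarrow> nat \<Rightarrow> (nat \<Rightarrow> complex \<Rightarrow> complex) set"
  where "seq_nbhd F k = {G. (\<forall>j. G j \<in> hol_disc) \<and>
    (\<forall>j<k. \<forall>z\<in>disc_exhaustion k. dist (G j z) (F j z) < radius_gap k)}"

text \<open>The weak inequality survives pointwise limits; these sets play the part of closed balls
  in Baire's argument.\<close>

definition seq_cnbhd :: "(nat \<Rightarrow> complex \<Rightarrow> complex) \<Rightarrow> nat \<Rightarrow> (nat \<Rightarrow> complex \<Rightarrow> complex) set"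
  where "seq_cnbhd F k = {G. (\<forall>j. G j \<in> hol_disc) \<and>
    (\<forall>j<k. \<forall>z\<in>disc_exhaustion k. dist (G j z) (F j z) \<le> radius_gap k)}"

lemma seq_nbhd_antimono:
  assumes "k \<le> m"
  shows "seq_nbhd F m \<subseteq> seq_nbhd F k"
proof
  fix G assume G: "G \<in> seq_nbhd F m"
  have "dist (G j z) (F j z) < radius_gap k"
    if "j < k" "z \<in> disc_exhaustion k" for j z
  proof -
    have "z \<in> disc_exhaustion m" using that(2) disc_exhaustion_mono[OF assms] by auto
    then have "dist (G j z) (F j z) < radius_gap m"
      using G that(1) assms unfolding seq_nbhd_def by auto
    then show ?thesis using radius_gap_antimono[OF assms] by linarith
  qed
  then show "G \<in> seq_nbhd F k" using G unfolding seq_nbhd_def by blast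
qed

text \<open>Strict decrease of \<open>radius_gap\<close> turns the weak inequality into a strict one
  at the cost of one index.\<close>

lemma seq_cnbhd_Suc: "seq_cnbhd F (Suc k) \<subseteq> seq_nbhd F k"
proof
  fix G assume G: "G \<in> seq_cnbhd F (Suc k)"
  have "dist (G j z) (F j z) < radius_gap k"
    if "j < k" "z \<in> disc_exhaustion k" for j z
  proof -
    have "z \<in> disc_exhaustion (Suc k)"
      using that(2) disc_exhaustion_mono[of k "Suc k"] by auto
    then have "dist (G j z) (F j z) \<le> radius_gap (Suc k)"
      using G that(1) unfolding seq_cnbhd_def by auto
    also have "\<dots> < radius_gap k" by (rule radius_gap_Suc_less)
    finally show ?thesis .
  qed
  then show "G \<in> seq_nbhd F k" using G unfolding seq_nbhd_def seq_cnbhd_def by blast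
qed

lemma seq_nbhd_subset_cnbhd: "seq_nbhd F k \<subseteq> seq_cnbhd F k"
  unfolding seq_nbhd_def seq_cnbhd_def by (auto intro: less_imp_le)

lemma openin_seq_nbhd:
  assumes "\<And>j. F j \<in> hol_disc"
  shows "openin hol_seq_topology (seq_nbhd F k)"
  unfolding seq_nbhd_def
proof (rule openin_hol_seq_topology_balls)
  show "disc_exhaustion k \<subseteq> disc" by (rule disc_exhaustion_subset)
  show "continuous_on (disc_exhaustion k) (F j)" for j
    using assms[of j] disc_exhaustion_subset holomorphic_on_imp_continuous_on holomorphic_on_subset
    unfolding hol_disc_def by blast
qed (rule compact_disc_exhaustion)

lemma openin_hol_seq_topology_nbhd:
  assumes U: "openin hol_seq_topology U" and F: "F \<in> U"
  obtains k where "seq_nbhd F k \<subseteq> U"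
proof -
  obtain V where fin: "finite {i. V i \<noteq> hol_disc}" and V: "\<And>i. openin hol_topology (V i)"
    and FV: "F \<in> Pi\<^sub>E UNIV V" and VU: "Pi\<^sub>E UNIV V \<subseteq> U"
    using U F unfolding openin_product_topology_alt topspace_hol_topology by auto
  have "\<exists>k. {g \<in> hol_disc. \<forall>z\<in>disc_exhaustion k. dist (g z) (F i z) < radius_gap k} \<subseteq> V i" for i
    using openin_hol_topology_nbhd[OF V, of "F i" i] FV by blast
  then have ex: "\<forall>i. \<exists>k. {g \<in> hol_disc. \<forall>z\<in>disc_exhaustion k. dist (g z) (F i z) < radius_gap k} \<subseteq> V i"
    by (rule allI)
  obtain k where k: "\<forall>i. {g \<in> hol_disc. \<forall>z\<in>disc_exhaustion (k i). dist (g z) (F i z) < radius_gap (k i)} \<subseteq> V i"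
    using choice[OF ex] by (rule exE) blast
  \<comment> \<open>A sum over the finitely many restricted coordinates dominates each
    \<open>k i\<close>, and the summand \<open>Suc i\<close> ensures \<open>i < m\<close>, so that
    coordinate \<open>i\<close> is among those controlled.\<close>
  define m where "m = (\<Sum>i\<in>{i. V i \<noteq> hol_disc}. k i + Suc i)"
  have "seq_nbhd F m \<subseteq> Pi\<^sub>E UNIV V"
  proof
    fix G assume G: "G \<in> seq_nbhd F m"
    have "G i \<in> V i" for i
    proof (cases "V i = hol_disc")
      case True
      then show ?thesis using G by (simp add: seq_nbhd_def)
    next
      case False
      then have "k i + Suc i \<le> m"
        using fin member_le_sum[of i "{i. V i \<noteq> hol_disc}" "\<lambda>i. k i + Suc i"] by (simp add: m_def)
      then have "G \<in> seq_nbhd F (k i + Suc i)" using seq_nbhd_antimono G by blast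
      then have 1: "G i \<in> hol_disc" and
        2: "\<forall>z\<in>disc_exhaustion (k i + Suc i). dist (G i z) (F i z) < radius_gap (k i + Suc i)"
        by (auto simp: seq_nbhd_def)
      have le: "radius_gap (k i + Suc i) \<le> radius_gap (k i)"
        by (rule radius_gap_antimono) simp
      have "dist (G i z) (F i z) < radius_gap (k i)" if "z \<in> disc_exhaustion (k i)" for z
      proof -
        have "z \<in> disc_exhaustion (k i + Suc i)" using that disc_exhaustion_mono[of "k i" "k i + Suc i"] by auto
        then show ?thesis using 2 le by fastforce
      qed
      then show ?thesis using 1 spec[OF k, of i] by blast
    qed
    then show "G \<in> Pi\<^sub>E UNIV V" by auto
  qed
  from this VU have "seq_nbhd F m \<subseteq> U" by (rule subset_trans)
  then show thesis by (rule that)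
qed

section \<open>Completeness and Baire's theorem\<close>

text \<open>Completeness without a metric: \<open>n \<le> k n\<close> makes every coordinate
  eventually controlled and the tolerances tend to 0, so the centres are Cauchy at each point. The
  limit is locally uniform, hence holomorphic, and inherits the weak inequalities.\<close>

lemma seq_cnbhd_limit:
  assumes F: "\<And>n j. F n j \<in> hol_disc" and k: "\<And>n. n \<le> k n"
    and nest: "\<And>m n. n \<le> m \<Longrightarrow> F m \<in> seq_cnbhd (F n) (k n)"
  shows "\<exists>G. \<forall>n. G \<in> seq_cnbhd (F n) (k n)"
proof -
  have close: "dist (F m j z) (F n j z) \<le> radius_gap (k n)"
    if "n \<le> m" "j < k n" "z \<in> disc_exhaustion (k n)" for m n j z
    using nest[OF that(1)] that(2,3) unfolding seq_cnbhd_def by blast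
  have conv: "convergent (\<lambda>n. F n j z)" if z: "z \<in> disc" for j z
    unfolding Cauchy_convergent_iff[symmetric]
  proof (rule CauchyI')
    fix e :: real assume "e > 0"
    obtain N where N: "{z} \<subseteq> disc_exhaustion N"
      using compact_subset_disc[of "{z}"] z by auto
    obtain M where M: "radius_gap M < e" using \<open>e > 0\<close> radius_gap_arch by blast
    show "\<exists>M. \<forall>m\<ge>M. \<forall>n>m. dist (F m j z) (F n j z) < e"
    proof (intro exI allI impI)
      fix m m' assume m: "Suc j + N + M \<le> m" "m < m'"
      have "k m \<ge> m" by (rule k)
      then have "j < k m" "N \<le> k m" "M \<le> k m" using m by auto
      then have "z \<in> disc_exhaustion (k m)" "radius_gap (k m) < e"
        using N M disc_exhaustion_mono[of N "k m"] radius_gap_antimono[of M "k m"] by auto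
      then show "dist (F m j z) (F m' j z) < e"
        using close[of m m' j z] m \<open>j < k m\<close> by (simp add: dist_commute)
    qed
  qed
  define G where "G = (\<lambda>j. \<lambda>z\<in>disc. lim (\<lambda>n. F n j z))"
  have lim: "(\<lambda>n. F n j z) \<longlonglongrightarrow> G j z" if "z \<in> disc" for j z
    using conv[OF that] that by (simp add: G_def convergent_LIMSEQ_iff)
  have Gclose: "dist (G j z) (F n j z) \<le> radius_gap (k n)"
    if "j < k n" "z \<in> disc_exhaustion (k n)" for n j z
  proof -
    have "z \<in> disc" using that(2) disc_exhaustion_subset by blast
    then have "(\<lambda>m. dist (F m j z) (F n j z)) \<longlonglongrightarrow> dist (G j z) (F n j z)"
      by (intro tendsto_intros lim)
    then show ?thesis
      by (rule LIMSEQ_le_const2) (use close that in blast)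
  qed
  have "G j holomorphic_on disc" for j
  proof (rule holomorphic_uniform_sequence[of _ "\<lambda>n. F n j"])
    show "F n j holomorphic_on disc" for n using F[of n j] by (simp add: hol_disc_def)
    fix x :: complex assume "x \<in> disc"
    then obtain d where d: "d > 0" "cball x d \<subseteq> disc" using open_contains_cball by blast
    obtain N where N: "cball x d \<subseteq> disc_exhaustion N"
      using compact_subset_disc[OF compact_cball d(2)] .
    have "uniform_limit (cball x d) (\<lambda>n. F n j) (G j) sequentially"
    proof (rule uniform_limitI)
      fix e :: real assume "e > 0"
      then obtain M where M: "radius_gap M < e" using radius_gap_arch by blast
      show "\<forall>\<^sub>F n in sequentially. \<forall>z\<in>cball x d. dist (F n j z) (G j z) < e"
        unfolding eventually_sequentially
      proof (intro exI allI impI ballI)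
        fix n z assume n: "Suc j + N + M \<le> n" and z: "z \<in> cball x d"
        have "k n \<ge> n" by (rule k)
        then have kn: "j < k n" "N \<le> k n" "M \<le> k n" using n by auto
        have "z \<in> disc_exhaustion (k n)"
          using N z disc_exhaustion_mono[OF kn(2)] by auto
        then have "dist (G j z) (F n j z) \<le> radius_gap (k n)" using Gclose kn by blast
        then show "dist (F n j z) (G j z) < e"
          using M radius_gap_antimono[OF kn(3)] unfolding dist_commute[of "F n j z"] by linarith
      qed
    qed
    then show "\<exists>d>0. cball x d \<subseteq> disc \<and> uniform_limit (cball x d) (\<lambda>n. F n j) (G j) sequentially"
      using d by blast
  qed simp
  then have "G j \<in> hol_disc" for j by (simp add: hol_disc_def G_def)
  then show ?thesis using Gclose unfolding seq_cnbhd_def by blast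
qed

text \<open>The classical nested-ball argument, with centre and index chosen together by dependent
  choice.\<close>

lemma hol_seq_Baire:
  assumes U: "\<And>n. openin hol_seq_topology (U n)"
    and dense: "\<And>n F k. (\<And>j. F j \<in> hol_disc) \<Longrightarrow> seq_nbhd F k \<inter> U n \<noteq> {}"
    and F: "\<And>j. F j \<in> hol_disc"
  shows "seq_nbhd F k \<inter> (\<Inter>n::nat. U n) \<noteq> {}"
proof -
  \<comment> \<open>The index of the \<open>n\<close>-th neighbourhood is at least \<open>n\<close>,
    as completeness demands; the clause for 0 keeps the construction inside the prescribed
    \<open>seq_nbhd F k\<close>.\<close>
  define P where "P = (\<lambda>(n::nat) x. (\<forall>j. fst x j \<in> hol_disc) \<and> n \<le> snd x \<and>
    (n = 0 \<longrightarrow> seq_cnbhd (fst x) (snd x) \<subseteq> seq_nbhd F k))"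
  define Q where "Q = (\<lambda>n x y. seq_cnbhd (fst y) (snd y) \<subseteq> U n \<inter> seq_nbhd (fst x) (snd x))"
  have "\<exists>x. \<forall>n. P n (x n) \<and> Q n (x n) (x (Suc n))"
  proof (rule dependent_nat_choice)
    show "\<exists>x. P 0 x"
      using F seq_cnbhd_Suc by (intro exI[of _ "(F, Suc k)"]) (auto simp: P_def)
  next
    fix x n assume x: "P n x"
    obtain G where G: "G \<in> seq_nbhd (fst x) (snd x)" "G \<in> U n"
      using dense[of "fst x" "snd x" n] x unfolding P_def by blast
    have "openin hol_seq_topology (U n \<inter> seq_nbhd (fst x) (snd x))"
      using x by (intro openin_Int U openin_seq_nbhd) (auto simp: P_def)
    then obtain m where m: "seq_nbhd G m \<subseteq> U n \<inter> seq_nbhd (fst x) (snd x)"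
      using openin_hol_seq_topology_nbhd G by (metis IntI)
    \<comment> \<open>\<open>m\<close> gives the containment, \<open>n\<close> the growth of the
      indices, and \<open>Suc\<close> passes from a weak to a strict neighbourhood.\<close>
    have "seq_cnbhd G (Suc (max m n)) \<subseteq> seq_nbhd G m"
      using seq_cnbhd_Suc seq_nbhd_antimono[of m "max m n"] by (meson max.cobounded1 subset_trans)
    moreover have "G j \<in> hol_disc" for j using G(1) by (simp add: seq_nbhd_def)
    ultimately show "\<exists>y. P (Suc n) y \<and> Q n x y"
      using m by (intro exI[of _ "(G, Suc (max m n))"]) (auto simp: P_def Q_def)
  qed
  then obtain x where P: "\<And>n. P n (x n)" and Q: "\<And>n. Q n (x n) (x (Suc n))" by blast
  have step: "seq_cnbhd (fst (x (Suc n))) (snd (x (Suc n))) \<subseteq> seq_cnbhd (fst (x n)) (snd (x n))" for n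
    using Q[of n] seq_nbhd_subset_cnbhd unfolding Q_def by blast
  have "seq_cnbhd (fst (x m)) (snd (x m)) \<subseteq> seq_cnbhd (fst (x n)) (snd (x n))" if "n \<le> m" for m n
    using step that by (rule lift_Suc_antimono_le)
  moreover have self: "fst (x n) \<in> seq_cnbhd (fst (x n)) (snd (x n))" for n
    using P[of n] by (simp add: P_def seq_cnbhd_def radius_gap_pos less_imp_le)
  ultimately have nest: "fst (x m) \<in> seq_cnbhd (fst (x n)) (snd (x n))" if "n \<le> m" for m n
    using that by blast
  have "\<exists>G. \<forall>n. G \<in> seq_cnbhd (fst (x n)) (snd (x n))"
    by (rule seq_cnbhd_limit) (use P nest in \<open>auto simp: P_def\<close>)
  then obtain G where G: "\<And>n. G \<in> seq_cnbhd (fst (x n)) (snd (x n))" by blast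
  have "G \<in> seq_nbhd F k" using G[of 0] P[of 0] unfolding P_def by blast
  moreover have "G \<in> U n" for n using G[of "Suc n"] Q[of n] unfolding Q_def by blast
  ultimately show ?thesis by blast
qed

lemma hol_seq_dense_gdelta:
  assumes I: "countable I" "I \<noteq> {}" and U: "\<And>i. i \<in> I \<Longrightarrow> openin hol_seq_topology (U i)"
    and dense: "\<And>i F k. i \<in> I \<Longrightarrow> (\<And>j. F j \<in> hol_disc) \<Longrightarrow> seq_nbhd F k \<inter> U i \<noteq> {}"
  shows "gdelta_in hol_seq_topology (\<Inter>i\<in>I. U i)" "dense_in hol_seq_topology (\<Inter>i\<in>I. U i)"
proof -
  show "gdelta_in hol_seq_topology (\<Inter>i\<in>I. U i)"
    using I U by (intro gdelta_in_Inter) (auto intro: open_imp_gdelta_in)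
  have eq: "(\<Inter>i\<in>I. U i) = (\<Inter>n. U (from_nat_into I n))"
    using range_from_nat_into[OF I(2,1)] by (metis image_image)
  have sub: "(\<Inter>i\<in>I. U i) \<subseteq> topspace hol_seq_topology"
    using I(2) U openin_subset by blast
  have "F \<in> hol_seq_topology closure_of (\<Inter>i\<in>I. U i)" if "F \<in> topspace hol_seq_topology" for F
    unfolding in_closure_of
  proof (intro conjI allI impI that)
    fix T assume T: "F \<in> T \<and> openin hol_seq_topology T"
    then obtain k where k: "seq_nbhd F k \<subseteq> T" using openin_hol_seq_topology_nbhd by blast
    have F: "F j \<in> hol_disc" for j using that unfolding topspace_hol_seq_topology by blast
    have "seq_nbhd F k \<inter> (\<Inter>n. U (from_nat_into I n)) \<noteq> {}"
      by (rule hol_seq_Baire) (use U dense F from_nat_into[OF I(2)] in auto)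
    then show "\<exists>y. y \<in> (\<Inter>i\<in>I. U i) \<and> y \<in> T" using k unfolding eq by blast
  qed
  then have "topspace hol_seq_topology \<subseteq> hol_seq_topology closure_of (\<Inter>i\<in>I. U i)"
    by (rule subsetI)
  then show "dense_in hol_seq_topology (\<Inter>i\<in>I. U i)"
    unfolding dense_in_def by (intro conjI sub subset_antisym closure_of_subset_topspace)
qed

section \<open>Polynomials of jointly universal families\<close>

text \<open>Dedekind's argument for characters: subtracting \<open>\<psi> s y\<close> times the
  relation at \<open>x\<close> from the relation at \<open>comp y x\<close> eliminates
  \<open>s\<close>, and the new coefficients \<open>a i * (\<psi> i y - \<psi> s y)\<close> vanish
  for every \<open>y\<close> by induction.\<close>

lemma multiplicative_functions_independent:
  fixes \<psi> :: "'i \<Rightarrow> 'a \<Rightarrow> complex" and comp :: "'a \<Rightarrow> 'a \<Rightarrow> 'a"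
  assumes "finite S" and mult: "\<And>i x y. i \<in> S \<Longrightarrow> \<psi> i (comp x y) = \<psi> i x * \<psi> i y"
    and nz: "\<And>i. i \<in> S \<Longrightarrow> \<exists>x. \<psi> i x \<noteq> 0"
    and distinct: "\<And>i j. i \<in> S \<Longrightarrow> j \<in> S \<Longrightarrow> i \<noteq> j \<Longrightarrow> \<exists>x. \<psi> i x \<noteq> \<psi> j x"
    and zero: "\<And>x. (\<Sum>i\<in>S. a i * \<psi> i x) = 0"
  shows "\<forall>i\<in>S. a i = 0"
  using assms
proof (induction S arbitrary: a rule: finite_induct)
  case empty
  then show ?case by simp
next
  case (insert s S)
  have "\<forall>i\<in>S. a i * (\<psi> i y - \<psi> s y) = 0" for y
  proof (rule insert.IH)
    fix x
    have "(\<Sum>i\<in>insert s S. a i * \<psi> i (comp y x)) - \<psi> s y * (\<Sum>i\<in>insert s S. a i * \<psi> i x) = 0"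
      using insert.prems(4) by simp
    also have "(\<Sum>i\<in>insert s S. a i * \<psi> i (comp y x)) = (\<Sum>i\<in>insert s S. a i * \<psi> i y * \<psi> i x)"
      by (intro sum.cong refl) (simp add: insert.prems(1))
    also have "(\<Sum>i\<in>insert s S. a i * \<psi> i y * \<psi> i x) - \<psi> s y * (\<Sum>i\<in>insert s S. a i * \<psi> i x)
        = (\<Sum>i\<in>S. a i * (\<psi> i y - \<psi> s y) * \<psi> i x)"
      using insert.hyps
      by (simp add: sum_distrib_left algebra_simps sum_subtractf)
    finally show "(\<Sum>i\<in>S. a i * (\<psi> i y - \<psi> s y) * \<psi> i x) = 0" .
  qed (use insert.prems in auto)
  then have S: "a i = 0" if "i \<in> S" for i
    using insert.prems(3)[of i s] insert.hyps(2) that by auto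
  obtain x where "\<psi> s x \<noteq> 0" using insert.prems(2) by blast
  moreover have "a s * \<psi> s x = 0"
    using insert.prems(4)[of x] insert.hyps S by simp
  ultimately show ?case using S by auto
qed

text \<open>Distinct monomials are distinct multiplicative functions, hence linearly independent.\<close>

lemma mpoly_eval_zero_imp_zero:
  assumes "\<And>x. mpoly_eval P x = 0"
  shows "P = 0"
proof -
  define \<psi> where "\<psi> = (\<lambda>(m :: nat \<Rightarrow>\<^sub>0 nat) (x :: nat \<Rightarrow> complex).
    \<Prod>i\<in>Poly_Mapping.keys m. x i ^ Poly_Mapping.lookup m i)"
  have "\<forall>m\<in>Poly_Mapping.keys P. Poly_Mapping.lookup P m = 0"
  proof (rule multiplicative_functions_independent[of _ \<psi> "\<lambda>x y i. x i * y i"])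
    show "\<psi> m (\<lambda>i. x i * y i) = \<psi> m x * \<psi> m y" for m x y
      by (simp add: \<psi>_def power_mult_distrib prod.distrib)
    show "\<exists>x. \<psi> m x \<noteq> 0" for m
      by (intro exI[of _ "\<lambda>_. 1"]) (simp add: \<psi>_def)
    show "\<exists>x. \<psi> m x \<noteq> \<psi> m' x" if neq: "m \<noteq> m'" for m m'
    proof -
      obtain i where i: "Poly_Mapping.lookup m i \<noteq> Poly_Mapping.lookup m' i"
        using poly_mapping_eqI[of m m'] neq by blast
      \<comment> \<open>Putting 2 at coordinate \<open>i\<close> and 1 elsewhere isolates the
        exponent of that variable.\<close>
      have ev: "\<psi> m ((\<lambda>_. 1)(i := 2)) = 2 ^ Poly_Mapping.lookup m i" for m
      proof -
        have "\<psi> m ((\<lambda>_. 1)(i := 2)) = (\<Prod>j\<in>Poly_Mapping.keys m. if j = i then 2 ^ Poly_Mapping.lookup m i else 1)"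
          unfolding \<psi>_def by (intro prod.cong) auto
        also have "\<dots> = 2 ^ Poly_Mapping.lookup m i"
          by (auto simp: prod.delta in_keys_iff)
        finally show ?thesis .
      qed
      have "(2::complex) ^ Poly_Mapping.lookup m i \<noteq> 2 ^ Poly_Mapping.lookup m' i"
        using i by (metis norm_numeral norm_power one_less_numeral_iff power_inject_exp semiring_norm(76))
      then show ?thesis using ev by metis
    qed
    show "(\<Sum>m\<in>Poly_Mapping.keys P. Poly_Mapping.lookup P m * \<psi> m x) = 0" for x
      using assms[of x] by (simp add: mpoly_eval_def \<psi>_def)
  qed auto
  then show ?thesis by (metis in_keys_iff keys_eq_empty ex_in_conv)
qed

lemma mpoly_eval_cong:
  assumes "\<And>i. i \<in> mpoly_vars P \<Longrightarrow> x i = y i"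
  shows "mpoly_eval P x = mpoly_eval P y"
  unfolding mpoly_eval_def
  by (intro sum.cong prod.cong refl arg_cong2[of _ _ _ _ "(*)"] arg_cong2[of _ _ _ _ "(^)"] assms)
     (auto simp: mpoly_vars_def)

lemma mpoly_eval_ray:
  obtains q where "\<And>t. poly q t = mpoly_eval P (\<lambda>i. t * d i)"
proof
  show "poly (\<Sum>m\<in>Poly_Mapping.keys P. smult (Poly_Mapping.lookup P m)
      (\<Prod>i\<in>Poly_Mapping.keys m. [:0, d i:] ^ Poly_Mapping.lookup m i)) t =
      mpoly_eval P (\<lambda>i. t * d i)" for t
    by (simp add: mpoly_eval_def poly_sum poly_prod)
qed

lemma mpoly_eval_holomorphic:
  assumes "\<And>i. i \<in> mpoly_vars P \<Longrightarrow> b i holomorphic_on S"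
  shows "(\<lambda>z. mpoly_eval P (\<lambda>i. b i z)) holomorphic_on S"
  unfolding mpoly_eval_def using assms
  by (intro holomorphic_intros) (auto simp: mpoly_vars_def)

section \<open>Uniform limits of polynomial expressions\<close>

text \<open>Uniform limits multiply when the limit functions are bounded; boundedness of the product
  is part of the conclusion because the induction needs it for the next factor.\<close>

lemma uniform_limit_bounded_prod:
  fixes f :: "'i \<Rightarrow> 'n \<Rightarrow> 'a \<Rightarrow> complex"
  assumes "finite I" "\<And>i. i \<in> I \<Longrightarrow> uniform_limit K (f i) (l i) F" "\<And>i. i \<in> I \<Longrightarrow> bounded (l i ` K)"
  shows "uniform_limit K (\<lambda>n x. \<Prod>i\<in>I. f i n x) (\<lambda>x. \<Prod>i\<in>I. l i x) F \<and> bounded ((\<lambda>x. \<Prod>i\<in>I. l i x) ` K)"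
  using assms
proof (induction I rule: finite_induct)
  case empty
  then show ?case by (auto simp: image_constant_conv intro: uniform_limit_const)
next
  case (insert j I)
  then have IH: "uniform_limit K (\<lambda>n x. \<Prod>i\<in>I. f i n x) (\<lambda>x. \<Prod>i\<in>I. l i x) F"
    "bounded ((\<lambda>x. \<Prod>i\<in>I. l i x) ` K)" by auto
  have "uniform_limit K (\<lambda>n x. f j n x * (\<Prod>i\<in>I. f i n x)) (\<lambda>x. l j x * (\<Prod>i\<in>I. l i x)) F"
    using insert.prems IH by (intro uniform_lim_mult) auto
  moreover have "bounded ((\<lambda>x. l j x * (\<Prod>i\<in>I. l i x)) ` K)"
  proof -
    obtain A where "\<And>x. x \<in> K \<Longrightarrow> norm (l j x) \<le> A"
      using insert.prems(2)[of j] by (auto simp: bounded_iff)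
    moreover obtain B where "\<And>x. x \<in> K \<Longrightarrow> norm (\<Prod>i\<in>I. l i x) \<le> B"
      using IH(2) by (auto simp: bounded_iff)
    ultimately have "norm (l j x * (\<Prod>i\<in>I. l i x)) \<le> A * B" if "x \<in> K" for x
      unfolding norm_mult using that by (intro mult_mono) (auto intro: order_trans[OF norm_ge_zero])
    then show ?thesis unfolding bounded_iff by blast
  qed
  ultimately show ?case using insert.hyps by simp
qed

lemma uniform_limit_finite_sum:
  fixes f :: "'i \<Rightarrow> 'n \<Rightarrow> 'a \<Rightarrow> complex"
  assumes "\<And>i. i \<in> I \<Longrightarrow> uniform_limit K (f i) (l i) F"
  shows "uniform_limit K (\<lambda>n x. \<Sum>i\<in>I. f i n x) (\<lambda>x. \<Sum>i\<in>I. l i x) F"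
  using assms
  by (induction I rule: infinite_finite_induct) (auto intro: uniform_limit_const uniform_limit_add)

lemma uniform_limit_mpoly_eval:
  assumes lim: "\<And>i. i \<in> mpoly_vars P \<Longrightarrow> uniform_limit K (\<lambda>n \<zeta>. g n i \<zeta>) (\<phi> i) F"
    and bdd: "\<And>i. i \<in> mpoly_vars P \<Longrightarrow> bounded (\<phi> i ` K)"
  shows "uniform_limit K (\<lambda>n \<zeta>. mpoly_eval P (\<lambda>i. g n i \<zeta>)) (\<lambda>\<zeta>. mpoly_eval P (\<lambda>i. \<phi> i \<zeta>)) F"
  unfolding mpoly_eval_def
proof (rule uniform_limit_finite_sum)
  fix m assume m: "m \<in> Poly_Mapping.keys P"
  \<comment> \<open>A power is the product of \<open>e\<close> equal factors, indexed by
    \<open>{..<e}\<close>.\<close>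
  have pow: "uniform_limit K (\<lambda>n \<zeta>. g n i \<zeta> ^ e) (\<lambda>\<zeta>. \<phi> i \<zeta> ^ e) F \<and> bounded ((\<lambda>\<zeta>. \<phi> i \<zeta> ^ e) ` K)"
    if "i \<in> Poly_Mapping.keys m" for i e
  proof -
    have "i \<in> mpoly_vars P" using m that by (auto simp: mpoly_vars_def)
    then show ?thesis
      using uniform_limit_bounded_prod[where I = "{..<e}" and K = K and F = F
          and f = "\<lambda>_ n \<zeta>. g n i \<zeta>" and l = "\<lambda>_. \<phi> i"] lim bdd by simp
  qed
  have "uniform_limit K (\<lambda>n \<zeta>. \<Prod>i\<in>Poly_Mapping.keys m. g n i \<zeta> ^ Poly_Mapping.lookup m i)
     (\<lambda>\<zeta>. \<Prod>i\<in>Poly_Mapping.keys m. \<phi> i \<zeta> ^ Poly_Mapping.lookup m i) F"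
    by (rule conjunct1[OF uniform_limit_bounded_prod]) (use pow in auto)
  then show "uniform_limit K (\<lambda>n \<zeta>. Poly_Mapping.lookup P m * (\<Prod>i\<in>Poly_Mapping.keys m. g n i \<zeta> ^ Poly_Mapping.lookup m i))
     (\<lambda>\<zeta>. Poly_Mapping.lookup P m * (\<Prod>i\<in>Poly_Mapping.keys m. \<phi> i \<zeta> ^ Poly_Mapping.lookup m i)) F"
    by (rule bounded_linear_uniform_limit_intros)
qed

section \<open>Approximate lifting through a polynomial in one variable\<close>

text \<open>If every root of \<open>q - y\<close> were farther than \<open>\<delta>\<close> from
  \<open>t\<close>, the factorisation would give \<open>|q t - y|\<close> at least
  \<open>|lead_coeff q| * \<delta> ^ degree q\<close>. This bound depends on neither
  \<open>t\<close> nor \<open>y\<close>, so the same step size works along a whole path.\<close>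

lemma poly_solution_near:
  fixes q :: "complex poly"
  assumes "degree q > 0" "\<delta> > 0"
  obtains \<eta> where "\<eta> > 0" "\<And>t y. dist (poly q t) y < \<eta> \<Longrightarrow> \<exists>w. poly q w = y \<and> dist w t \<le> \<delta>"
proof
  have lc: "lead_coeff q \<noteq> 0" using assms(1) by auto
  show "norm (lead_coeff q) * \<delta> ^ degree q > 0" using lc assms by simp
  fix t y assume near: "dist (poly q t) y < norm (lead_coeff q) * \<delta> ^ degree q"
  define p where "p = q + [:- y:]"
  have deg: "degree p = degree q"
    using assms(1) by (simp add: p_def degree_add_eq_left)
  then have lcp: "lead_coeff p = lead_coeff q"
    using assms(1) by (simp add: p_def coeff_pCons split: nat.splits)
  have "p \<noteq> 0" using deg assms(1) by auto
  then obtain A where A: "size A = degree p" "p = smult (lead_coeff p) (\<Prod>x\<in>#A. [:- x, 1:])"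
    using alg_closed_imp_factorization by blast
  have ev: "poly p z = lead_coeff p * (\<Prod>x\<in>#A. z - x)" for z
    by (subst A(2)) (simp add: poly_prod_mset image_mset.compositionality o_def)
  have prod: "\<delta> ^ size B \<le> norm (\<Prod>x\<in>#B. t - x)" if "\<And>x. x \<in># B \<Longrightarrow> \<delta> \<le> dist x t" for B
    using that
  proof (induction B)
    case (add b B)
    then have "\<delta> * \<delta> ^ size B \<le> dist b t * norm (\<Prod>x\<in>#B. t - x)"
      using assms(2) by (intro mult_mono) auto
    then show ?case by (simp add: norm_mult dist_norm norm_minus_commute)
  qed simp
  show "\<exists>w. poly q w = y \<and> dist w t \<le> \<delta>"
  proof (rule ccontr)
    assume no: "\<not> (\<exists>w. poly q w = y \<and> dist w t \<le> \<delta>)"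
    have "\<delta> \<le> dist x t" if "x \<in># A" for x
    proof -
      have "poly p x = 0" using that by (simp add: ev)
      then show ?thesis using no by (fastforce simp: p_def)
    qed
    then have "\<delta> ^ degree q \<le> norm (\<Prod>x\<in>#A. t - x)" using prod[of A] A(1) deg by simp
    then have "norm (lead_coeff q) * \<delta> ^ degree q \<le> norm (poly p t)"
      unfolding ev lcp norm_mult by (intro mult_left_mono) auto
    then show False using near by (simp add: p_def dist_norm)
  qed
qed

lemma bounded_poly_preimage:
  fixes q :: "complex poly"
  assumes "degree q > 0"
  obtains R where "\<And>t. norm (poly q t) \<le> C \<Longrightarrow> norm t \<le> R"
proof -
  obtain a p where q: "q = pCons a p" by (cases q)
  with assms have "p \<noteq> 0" by auto
  then obtain R where R: "\<And>z. R \<le> norm z \<Longrightarrow> C + 1 \<le> norm (poly (pCons a p) z)"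
    using poly_infinity by blast
  have "norm t \<le> R" if "norm (poly q t) \<le> C" for t
    using R[of t] that q by force
  then show thesis by (rule that)
qed

lemma poly_surj:
  fixes q :: "complex poly"
  assumes "degree q > 0"
  obtains w where "poly q w = y"
proof -
  have "degree (q + [:- y:]) = degree q" using assms by (simp add: degree_add_eq_left)
  then have "\<not> constant (poly (q + [:- y:]))" using assms by (simp add: constant_degree)
  then obtain z where "poly (q + [:- y:]) z = 0" using fundamental_theorem_of_algebra by blast
  then show thesis using that by simp
qed

text \<open>Exact preimages are chosen only at the points of a fine grid, each close to the previous
  one, and joined by line segments. On one segment neither \<open>q\<close> nor
  \<open>\<gamma>\<close> varies by more than \<open>\<epsilon>/2\<close>.\<close>

lemma poly_path_lift_approx:
  fixes q :: "complex poly" and \<gamma> :: "real \<Rightarrow> complex"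
  assumes deg: "degree q > 0" and \<gamma>: "continuous_on {0..1} \<gamma>" and \<epsilon>: "\<epsilon> > 0"
  obtains T where "continuous_on {0..1} T" "\<And>u. u \<in> {0..1} \<Longrightarrow> dist (poly q (T u)) (\<gamma> u) < \<epsilon>"
proof -
  have "bounded (\<gamma> ` {0..1})"
    using \<gamma> by (simp add: compact_continuous_image compact_imp_bounded)
  then obtain C where "\<forall>y\<in>\<gamma> ` {0..1}. norm y \<le> C" unfolding bounded_iff by blast
  then have C: "\<And>u. u \<in> {0..1} \<Longrightarrow> norm (\<gamma> u) \<le> C" by blast
  obtain R where R: "\<And>t. norm (poly q t) \<le> C \<Longrightarrow> norm t \<le> R"
    by (rule bounded_poly_preimage[OF deg, of C]) blast
  \<comment> \<open>Preimages of values of \<open>\<gamma>\<close> have norm at most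
    \<open>R\<close>, and the segments stay within \<open>\<delta> \<le> 1\<close> of them.\<close>
  have "uniformly_continuous_on (cball 0 (R + 1)) (poly q)"
    by (intro compact_uniformly_continuous continuous_intros) auto
  then obtain \<delta>1 where \<delta>1: "\<delta>1 > 0" "\<And>x y. x \<in> cball 0 (R + 1) \<Longrightarrow> y \<in> cball 0 (R + 1) \<Longrightarrow>
      dist y x < \<delta>1 \<Longrightarrow> dist (poly q y) (poly q x) < \<epsilon>/2"
    unfolding uniformly_continuous_on_def using half_gt_zero[OF \<epsilon>] by metis
  define \<delta> where "\<delta> = min 1 (\<delta>1/2)"
  have \<delta>: "\<delta> > 0" "\<delta> \<le> 1" "\<delta> < \<delta>1" using \<delta>1(1) by (auto simp: \<delta>_def)
  obtain \<eta> where \<eta>: "\<eta> > 0" "\<And>t y. dist (poly q t) y < \<eta> \<Longrightarrow> \<exists>w. poly q w = y \<and> dist w t \<le> \<delta>"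
    by (rule poly_solution_near[OF deg \<delta>(1)]) blast
  have "uniformly_continuous_on {0..1} \<gamma>"
    using \<gamma> by (intro compact_uniformly_continuous) auto
  \<comment> \<open>\<open>\<eta>\<close> provides the next preimage near the current one,
    \<open>\<epsilon>/2\<close> controls \<open>\<gamma>\<close> on one piece.\<close>
  moreover have "min \<eta> (\<epsilon>/2) > 0" using \<eta>(1) \<epsilon> by simp
  ultimately obtain \<delta>2 where \<delta>2: "\<delta>2 > 0" "\<And>x y. x \<in> {0..1} \<Longrightarrow> y \<in> {0..1} \<Longrightarrow>
      dist y x < \<delta>2 \<Longrightarrow> dist (\<gamma> y) (\<gamma> x) < min \<eta> (\<epsilon>/2)"
    unfolding uniformly_continuous_on_def by metis
  obtain M where M: "inverse (real (Suc M)) < \<delta>2" using \<delta>2(1) reals_Archimedean by blast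
  define h where "h = inverse (real (Suc M))"
  have h: "h > 0" "h < \<delta>2" "real (Suc M) * h = 1" using M by (auto simp: h_def)
  \<comment> \<open>Exactness at the right endpoint is carried along: it starts the next piece from
    a true preimage and renews the bound \<open>R\<close>, so errors do not accumulate.\<close>
  have "\<exists>T. continuous_on {0..real n * h} T \<and> poly q (T (real n * h)) = \<gamma> (real n * h) \<and>
      (\<forall>u\<in>{0..real n * h}. dist (poly q (T u)) (\<gamma> u) < \<epsilon>)" if "n \<le> Suc M" for n
    using that
  proof (induction n)
    case 0
    obtain w where "poly q w = \<gamma> 0" using poly_surj[OF deg] .
    then show ?case using \<epsilon> by (intro exI[of _ "\<lambda>_. w"]) auto
  next
    case (Suc n)
    define a b where "a = real n * h" and "b = real (Suc n) * h"
    have ab: "b = a + h" "0 \<le> a" "a \<le> 1" "0 \<le> b" "b \<le> 1"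
    proof -
      have "real (Suc n) * h \<le> real (Suc M) * h" using Suc.prems h(1) by (intro mult_right_mono) auto
      then show "b \<le> 1" unfolding b_def h(3) .
      then show "a \<le> 1" using h(1) by (simp add: a_def b_def algebra_simps)
    qed (use h in \<open>auto simp: a_def b_def algebra_simps\<close>)
    obtain T where T: "continuous_on {0..a} T" "poly q (T a) = \<gamma> a"
      "\<And>u. u \<in> {0..a} \<Longrightarrow> dist (poly q (T u)) (\<gamma> u) < \<epsilon>"
      using Suc unfolding a_def by auto
    have "dist (poly q (T a)) (\<gamma> b) < \<eta>"
      using \<delta>2(2)[of b a] ab h by (simp add: T(2) dist_real_def)
    then obtain w where w: "poly q w = \<gamma> b" "dist w (T a) \<le> \<delta>" using \<eta>(2) by blast
    define T' where "T' = (\<lambda>u. if u \<le> a then T u else T a + of_real ((u - a) / h) * (w - T a))"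
    have Ta: "norm (T a) \<le> R" using R T(2) C[of a] ab by simp
    have cont: "continuous_on {0..b} T'"
      unfolding T'_def
    proof (rule continuous_on_cases_le)
      show "continuous_on {u \<in> {0..b}. u \<le> a} T" by (rule continuous_on_subset[OF T(1)]) auto
    qed (use h in \<open>auto intro!: continuous_intros\<close>)
    have end': "T' b = w" using ab h by (simp add: T'_def)
    have "dist (poly q (T' u)) (\<gamma> u) < \<epsilon>" if u: "u \<in> {0..b}" for u
    proof (cases "u \<le> a")
      case True
      then show ?thesis using T(3) u by (simp add: T'_def)
    next
      case False
      define s where "s = (u - a) / h"
      have s: "0 \<le> s" "s \<le> 1" using False u ab h by (auto simp: s_def)
      have "T' u = T a + of_real s * (w - T a)" using False by (simp add: T'_def s_def)
      then have "dist (T' u) (T a) = s * dist w (T a)"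
        using s by (simp add: dist_norm norm_mult)
      also have "\<dots> \<le> 1 * \<delta>" using s w by (intro mult_mono) auto
      finally have d: "dist (T' u) (T a) \<le> \<delta>" by simp
      then have "norm (T' u) \<le> R + 1"
        using Ta \<delta> norm_triangle_ineq2[of "T' u" "T a"] by (simp add: dist_norm)
      then have 1: "dist (\<gamma> a) (poly q (T' u)) < \<epsilon>/2"
        using \<delta>1(2)[of "T a" "T' u"] Ta d \<delta> T(2) by (simp add: dist_commute)
      have 2: "dist (\<gamma> a) (\<gamma> u) < \<epsilon>/2"
        using \<delta>2(2)[of u a] False u ab h by (auto simp: dist_real_def)
      show ?thesis using 1 2 by (rule dist_triangle_half_r)
    qed
    then show ?case
      using cont end' w(1) unfolding b_def by (intro exI[of _ T']) auto
  qed
  from this[of "Suc M"] show thesis using that h(3) by auto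
qed

text \<open>The circle without a point \<open>\<omega>\<close> outside \<open>K\<close> is parametrised by an interval, so lifting through
  \<open>q\<close> reduces to paths.\<close>

lemma circle_poly_lift_approx:
  fixes q :: "complex poly"
  assumes deg: "degree q > 0" and K: "compact K" "K \<subset> circle"
    and \<phi>: "continuous_on K \<phi>" and \<epsilon>: "\<epsilon> > 0"
  obtains T where "continuous_on K T" "\<And>\<zeta>. \<zeta> \<in> K \<Longrightarrow> dist (poly q (T \<zeta>)) (\<phi> \<zeta>) < \<epsilon>"
proof -
  \<comment> \<open>\<open>K\<close> may be any compact set; replacing \<open>\<phi>\<close> by a
    polynomial extends the target to the whole circle, and thus to a path on all of
    \<open>{0..1}\<close>.\<close>
  obtain p where p: "\<And>z. z \<in> K \<Longrightarrow> dist (poly p z) (\<phi> z) < \<epsilon>/2"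
    using continuous_circle_approx_poly[OF K \<phi>, of "\<epsilon>/2"] \<epsilon> by auto
  obtain \<omega> where \<omega>: "norm \<omega> = 1" "\<omega> \<notin> K" using psubset_imp_ex_mem[OF K(2)] by auto
  define \<gamma> where "\<gamma> = (\<lambda>u. poly p (\<omega> * exp (\<i> * of_real (2 * pi * u))))"
  have "continuous_on {0..1} \<gamma>" unfolding \<gamma>_def by (intro continuous_intros)
  then obtain T where T: "continuous_on {0..1} T" "\<And>u. u \<in> {0..1} \<Longrightarrow> dist (poly q (T u)) (\<gamma> u) < \<epsilon>/2"
    using poly_path_lift_approx[OF deg, of \<gamma> "\<epsilon>/2"] \<epsilon> by auto
  \<comment> \<open>The angle measured from \<open>\<omega>\<close>: \<open>Arg2pi\<close> jumps
    only on the nonnegative reals, which \<open>\<zeta> / \<omega>\<close> could meet only for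
    \<open>\<zeta> = \<omega>\<close>, outside \<open>K\<close>.\<close>
  define u where "u = (\<lambda>\<zeta>. Arg2pi (\<zeta> / \<omega>) / (2 * pi))"
  have u01: "u \<zeta> \<in> {0..1}" for \<zeta>
    using Arg2pi_ge_0[of "\<zeta> / \<omega>"] Arg2pi_lt_2pi[of "\<zeta> / \<omega>"] by (simp add: u_def)
  have \<omega>0: "\<omega> \<noteq> 0" using \<omega> by auto
  have "continuous_on K u"
    unfolding u_def
  proof (intro continuous_intros)
    show "continuous_on K (\<lambda>\<zeta>. Arg2pi (\<zeta> / \<omega>))"
    proof (rule continuous_on_compose2[of "- \<real>\<^sub>\<ge>\<^sub>0" Arg2pi])
      show "continuous_on (- \<real>\<^sub>\<ge>\<^sub>0) Arg2pi"
        by (intro continuous_at_imp_continuous_on ballI continuous_at_Arg2pi) auto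
      show "(\<lambda>\<zeta>. \<zeta> / \<omega>) ` K \<subseteq> - \<real>\<^sub>\<ge>\<^sub>0"
      proof clarify
        fix \<zeta> assume \<zeta>: "\<zeta> \<in> K" "\<zeta> / \<omega> \<in> \<real>\<^sub>\<ge>\<^sub>0"
        have "norm (\<zeta> / \<omega>) = 1" using \<zeta>(1) K(2) \<omega> by (auto simp: norm_divide)
        then have "\<zeta> / \<omega> = 1" using \<zeta>(2) by (auto elim!: nonneg_Reals_cases)
        then show False using \<zeta>(1) \<omega> \<omega>0 by simp
      qed
    qed (use \<omega>0 in \<open>auto intro!: continuous_intros\<close>)
  qed auto
  then have "continuous_on K (\<lambda>\<zeta>. T (u \<zeta>))"
    using u01 by (intro continuous_on_compose2[OF T(1)]) auto
  moreover have "dist (poly q (T (u \<zeta>))) (\<phi> \<zeta>) < \<epsilon>" if \<zeta>: "\<zeta> \<in> K" for \<zeta>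
  proof -
    have "norm (\<zeta> / \<omega>) = 1" using \<zeta> K(2) \<omega> by (auto simp: norm_divide)
    then have "exp (\<i> * of_real (Arg2pi (\<zeta> / \<omega>))) = \<zeta> / \<omega>" by (simp add: complex_norm_eq_1_exp)
    then have "\<gamma> (u \<zeta>) = poly p \<zeta>" using \<omega>0 by (simp add: \<gamma>_def u_def)
    then have "dist (poly p \<zeta>) (poly q (T (u \<zeta>))) < \<epsilon>/2"
      using T(2)[OF u01, of \<zeta>] by (simp add: dist_commute)
    then show ?thesis using p[OF \<zeta>] by (rule dist_triangle_half_r)
  qed
  ultimately show thesis by (rule that)
qed

section \<open>Joint universality and its consequences for the generated algebra\<close>

text \<open>One \<open>n\<close> serves all \<open>j < N\<close>; asking for
  \<open>n \<ge> l\<close> with arbitrary \<open>l\<close> is what later yields strictly increasing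
  indices.\<close>

definition jointly_universal :: "(nat \<Rightarrow> real) \<Rightarrow> (nat \<Rightarrow> complex \<Rightarrow> complex) \<Rightarrow> bool"
  where "jointly_universal r f \<longleftrightarrow>
    (\<forall>N K \<phi> \<epsilon> l. compact K \<and> K \<subset> circle \<and> (\<forall>j<N. continuous_on K (\<phi> j)) \<and> \<epsilon> > 0 \<longrightarrow>
      (\<exists>n\<ge>l. \<forall>j<N. \<forall>\<zeta>\<in>K. dist (f j (complex_of_real (r n) * \<zeta>)) (\<phi> j \<zeta>) < \<epsilon>))"

lemma strict_mono_choice:
  assumes "\<And>(\<epsilon>::real) l. \<epsilon> > 0 \<Longrightarrow> \<exists>n\<ge>l. R n \<epsilon>"
  shows "\<exists>n :: nat \<Rightarrow> nat. strict_mono n \<and> (\<forall>k. R (n k) (inverse (real (Suc k))))"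
proof -
  have "\<exists>n. \<forall>k. R (n k) (inverse (real (Suc k))) \<and> n k < n (Suc k)"
  proof (rule dependent_nat_choice)
    show "\<exists>x. R x (inverse (real (Suc 0)))" using assms[of "inverse (real (Suc 0))" 0] by auto
    show "\<exists>y. R y (inverse (real (Suc (Suc k)))) \<and> x < y" for x k
      using assms[of "inverse (real (Suc (Suc k)))" "Suc x"] by auto
  qed
  then show ?thesis by (auto simp: strict_mono_Suc_iff)
qed

lemma uniform_limit_inverse_Suc:
  fixes g :: "nat \<Rightarrow> 'a \<Rightarrow> 'b::metric_space"
  assumes "\<And>k \<zeta>. \<zeta> \<in> K \<Longrightarrow> dist (g k \<zeta>) (\<phi> \<zeta>) < inverse (real (Suc k))"
  shows "uniform_limit K g \<phi> sequentially"
proof (rule uniform_limitI)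
  fix e :: real assume "e > 0"
  with LIMSEQ_inverse_real_of_nat have "\<forall>\<^sub>F n in sequentially. inverse (real (Suc n)) < e"
    by (rule order_tendstoD)
  then show "\<forall>\<^sub>F n in sequentially. \<forall>\<zeta>\<in>K. dist (g n \<zeta>) (\<phi> \<zeta>) < e"
    by eventually_elim (use assms in \<open>auto intro: less_trans\<close>)
qed

lemma jointly_universal_uniform_limit:
  assumes f: "jointly_universal r f" and K: "compact K" "K \<subset> circle"
    and \<phi>: "\<And>j. j < N \<Longrightarrow> continuous_on K (\<phi> j)"
  obtains n :: "nat \<Rightarrow> nat" where "strict_mono n"
    "\<And>j. j < N \<Longrightarrow> uniform_limit K (\<lambda>k \<zeta>. f j (complex_of_real (r (n k)) * \<zeta>)) (\<phi> j) sequentially"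
proof -
  have "\<exists>n\<ge>l. \<forall>j<N. \<forall>\<zeta>\<in>K. dist (f j (complex_of_real (r n) * \<zeta>)) (\<phi> j \<zeta>) < \<epsilon>" if "\<epsilon> > 0" for \<epsilon> l
    using f K \<phi> that unfolding jointly_universal_def by blast
  then have "\<exists>n :: nat \<Rightarrow> nat. strict_mono n \<and>
    (\<forall>k. \<forall>j<N. \<forall>\<zeta>\<in>K. dist (f j (complex_of_real (r (n k)) * \<zeta>)) (\<phi> j \<zeta>) < inverse (real (Suc k)))"
    by (rule strict_mono_choice)
  then obtain n :: "nat \<Rightarrow> nat" where n: "strict_mono n"
    "\<forall>k. \<forall>j<N. \<forall>\<zeta>\<in>K. dist (f j (complex_of_real (r (n k)) * \<zeta>)) (\<phi> j \<zeta>) < inverse (real (Suc k))"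
    by blast
  show thesis
    by (rule that[OF n(1)], rule uniform_limit_inverse_Suc) (use n(2) in blast)
qed

text \<open>\<open>\<sigma>\<close> translates variables of \<open>P\<close> into positions in the
  sequence \<open>f\<close> and may identify variables; only finitely many positions occur, so one
  bound \<open>N\<close> covers them.\<close>

lemma jointly_universal_mpoly_eval:
  assumes f: "jointly_universal r f" and K: "compact K" "K \<subset> circle"
    and \<phi>: "\<And>j. continuous_on K (\<phi> j)" and fin: "finite (\<sigma> ` mpoly_vars P)"
  obtains n :: "nat \<Rightarrow> nat" where "strict_mono n"
    "uniform_limit K (\<lambda>k \<zeta>. mpoly_eval P (\<lambda>i. f (\<sigma> i) (complex_of_real (r (n k)) * \<zeta>)))
      (\<lambda>\<zeta>. mpoly_eval P (\<lambda>i. \<phi> (\<sigma> i) \<zeta>)) sequentially"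
proof -
  obtain N where N: "\<And>i. i \<in> mpoly_vars P \<Longrightarrow> \<sigma> i < N"
    using fin by (auto simp: finite_nat_set_iff_bounded)
  obtain n :: "nat \<Rightarrow> nat" where n: "strict_mono n"
    "\<And>j. j < N \<Longrightarrow> uniform_limit K (\<lambda>k \<zeta>. f j (complex_of_real (r (n k)) * \<zeta>)) (\<phi> j) sequentially"
    by (rule jointly_universal_uniform_limit[OF f K, of N \<phi>]) (use \<phi> in auto)
  have "bounded (\<phi> j ` K)" for j
    using \<phi> K by (simp add: compact_continuous_image compact_imp_bounded)
  then have "uniform_limit K (\<lambda>k \<zeta>. mpoly_eval P (\<lambda>i. f (\<sigma> i) (complex_of_real (r (n k)) * \<zeta>)))
      (\<lambda>\<zeta>. mpoly_eval P (\<lambda>i. \<phi> (\<sigma> i) \<zeta>)) sequentially"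
    using n(2) N by (intro uniform_limit_mpoly_eval) auto
  then show thesis using n(1) that by blast
qed

lemma singleton_one_psubset_circle: "{1} \<subset> circle"
proof -
  have "-1 \<in> circle" "-1 \<noteq> (1::complex)" by auto
  then have "circle \<noteq> {1}" by (metis singletonD)
  then show ?thesis by auto
qed

text \<open>Equal terms could not approximate the targets 0 and 1 at the same point
  simultaneously.\<close>

lemma jointly_universal_inj:
  assumes "jointly_universal r f"
  shows "inj f"
proof (rule injI, rule ccontr)
  fix i j assume ij: "f i = f j" "i \<noteq> j"
  define \<phi> where "\<phi> = (\<lambda>k (_::complex). if k = i then 0 else 1 :: complex)"
  have "\<exists>n\<ge>0. \<forall>k<Suc (i + j). \<forall>\<zeta>\<in>{1}. dist (f k (complex_of_real (r n) * \<zeta>)) (\<phi> k \<zeta>) < 1/2"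
  proof -
    have "compact {1::complex} \<and> {1} \<subset> circle \<and> (\<forall>k<Suc (i + j). continuous_on {1} (\<phi> k)) \<and> (1/2::real) > 0"
      using singleton_one_psubset_circle by auto
    then show ?thesis using assms unfolding jointly_universal_def by blast
  qed
  then obtain n where n: "\<And>k. k < Suc (i + j) \<Longrightarrow> dist (f k (complex_of_real (r n))) (\<phi> k 1) < 1/2"
    by auto
  have "dist (f i (complex_of_real (r n))) 0 < 1/2" "dist (f i (complex_of_real (r n))) 1 < 1/2"
    using n[of i] n[of j] ij by (auto simp: \<phi>_def)
  then have "dist (0::complex) 1 < 1" by (rule dist_triangle_half_r)
  then show False by simp
qed

lemma jointly_universal_algebraically_independent:
  assumes f: "jointly_universal r f" and r: "\<And>n. r n \<in> {0..<1}"
  shows "algebraically_independent (range f)"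
  unfolding algebraically_independent_def
proof (intro allI impI, elim conjE)
  fix P :: mpoly and b and n :: nat
  assume vars: "mpoly_vars P \<subseteq> {..<n}" and b: "\<forall>i<n. b i \<in> range f" and inj: "inj_on b {..<n}"
    and zero: "hol_eval P b = (\<lambda>z\<in>disc. 0)"
  define \<sigma> where "\<sigma> = (\<lambda>i. inv f (b i))"
  have \<sigma>: "b i = f (\<sigma> i)" if "i < n" for i
    using b that by (simp add: \<sigma>_def f_inv_into_f)
  have inj\<sigma>: "inj_on \<sigma> {..<n}"
    using inj \<sigma> unfolding inj_on_def by (metis lessThan_iff)
  show "P = 0"
  proof (rule mpoly_eval_zero_imp_zero)
    fix x
    \<comment> \<open>Constant targets realising the arbitrary point \<open>x\<close>:
      \<open>inv_into\<close> undoes the renaming, which is injective since the \<open>b i\<close>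
      are distinct.\<close>
    define \<phi> where "\<phi> = (\<lambda>j (_::complex). x (inv_into {..<n} \<sigma> j) :: complex)"
    have fin: "finite (\<sigma> ` mpoly_vars P)" using vars by (meson finite_imageI finite_lessThan finite_subset)
    obtain nk :: "nat \<Rightarrow> nat" where nk: "uniform_limit {1} (\<lambda>k \<zeta>. mpoly_eval P (\<lambda>i. f (\<sigma> i) (complex_of_real (r (nk k)) * \<zeta>)))
      (\<lambda>\<zeta>. mpoly_eval P (\<lambda>i. \<phi> (\<sigma> i) \<zeta>)) sequentially"
      by (rule jointly_universal_mpoly_eval[OF f _ singleton_one_psubset_circle _ fin, of \<phi>])
         (auto simp: \<phi>_def)
    have "mpoly_eval P (\<lambda>i. f (\<sigma> i) (complex_of_real (r m))) = 0" for m
    proof -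
      have "complex_of_real (r m) \<in> disc" using r[of m] by simp
      then have "mpoly_eval P (\<lambda>i. b i (complex_of_real (r m))) = 0"
        using fun_cong[OF zero, of "complex_of_real (r m)"] by (simp add: hol_eval_def)
      moreover have "mpoly_eval P (\<lambda>i. b i (complex_of_real (r m))) = mpoly_eval P (\<lambda>i. f (\<sigma> i) (complex_of_real (r m)))"
        using vars \<sigma> by (intro mpoly_eval_cong) auto
      ultimately show ?thesis by simp
    qed
    then have "(\<lambda>_. 0) \<longlonglongrightarrow> mpoly_eval P (\<lambda>i. \<phi> (\<sigma> i) 1)"
      using tendsto_uniform_limitI[OF nk, of 1] by simp
    then have "mpoly_eval P (\<lambda>i. \<phi> (\<sigma> i) 1) = 0"
      using LIMSEQ_unique tendsto_const by blast
    moreover have "mpoly_eval P (\<lambda>i. \<phi> (\<sigma> i) 1) = mpoly_eval P x"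
      using vars inv_into_f_f[OF inj\<sigma>] by (intro mpoly_eval_cong) (auto simp: \<phi>_def)
    ultimately show "mpoly_eval P x = 0" by simp
  qed
qed

text \<open>If the polynomial function \<open>P\<close> takes different values at \<open>0\<close> and \<open>d\<close>, its restriction \<open>q\<close> to the
  line through these points is a nonconstant polynomial in one variable, and simultaneous targets
  on that line suffice.\<close>

lemma jointly_universal_nonconstant:
  assumes f: "jointly_universal r f" and r: "\<And>n. r n \<in> {0..<1}" and hol: "\<And>j. f j \<in> hol_disc"
    and g: "g \<in> generated_subalgebra (range f)" and nc: "g \<notin> hol_constants"
  shows "g \<in> abel_universal_along r"
proof -
  obtain P b n where gP: "g = hol_eval P b" and vars: "mpoly_vars P \<subseteq> {..<n}"
    and b: "\<And>i. i < n \<Longrightarrow> b i \<in> range f"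
    using g unfolding generated_subalgebra_def by auto
  define \<sigma> where "\<sigma> = (\<lambda>i. inv f (b i))"
  have \<sigma>: "b i = f (\<sigma> i)" if "i < n" for i
    using b that by (simp add: \<sigma>_def f_inv_into_f)
  have fin: "finite (\<sigma> ` mpoly_vars P)" using vars by (meson finite_imageI finite_lessThan finite_subset)
  have g_eq: "g z = mpoly_eval P (\<lambda>i. f (\<sigma> i) z)" if "z \<in> disc" for z
  proof -
    have "g z = mpoly_eval P (\<lambda>i. b i z)" using that by (simp add: gP hol_eval_def)
    also have "\<dots> = mpoly_eval P (\<lambda>i. f (\<sigma> i) z)"
      using vars \<sigma> by (intro mpoly_eval_cong) auto
    finally show ?thesis .
  qed
  have "b i \<in> hol_disc" if "i < n" for i using b[OF that] hol by auto
  then have "(\<lambda>z. mpoly_eval P (\<lambda>i. b i z)) holomorphic_on disc"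
    using vars by (intro mpoly_eval_holomorphic) (auto simp: hol_disc_def)
  then have ghol: "g \<in> hol_disc"
    unfolding hol_disc_def gP hol_eval_def
    by (auto intro: holomorphic_transform)
  \<comment> \<open>\<open>d\<close> is indexed by positions in \<open>f\<close>, not by variables:
    \<open>b\<close> may repeat a term, and equal terms must receive equal values. If no such
    \<open>d\<close> existed, the choice \<open>d j = f j z\<close> would make \<open>g\<close>
    constant.\<close>
  have "\<exists>d. mpoly_eval P (\<lambda>i. d (\<sigma> i)) \<noteq> mpoly_eval P (\<lambda>i. 0)"
  proof (rule ccontr)
    assume "\<not> ?thesis"
    then have const: "mpoly_eval P (\<lambda>i. d (\<sigma> i)) = mpoly_eval P (\<lambda>i. 0)" for d
      by blast
    have "g = (\<lambda>z\<in>disc. mpoly_eval P (\<lambda>i. 0))"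
    proof
      fix z
      show "g z = (\<lambda>z\<in>disc. mpoly_eval P (\<lambda>i. 0)) z"
        using g_eq[of z] const[of "\<lambda>j. f j z"] by (cases "z \<in> disc") (auto simp: gP hol_eval_def)
    qed
    then show False using nc unfolding hol_constants_def by blast
  qed
  then obtain d where d: "mpoly_eval P (\<lambda>i. d (\<sigma> i)) \<noteq> mpoly_eval P (\<lambda>i. 0)" by blast
  obtain q where q: "\<And>t. poly q t = mpoly_eval P (\<lambda>i. t * d (\<sigma> i))"
    by (rule mpoly_eval_ray[of P "\<lambda>i. d (\<sigma> i)"]) blast
  have "poly q 0 \<noteq> poly q 1" using d by (simp add: q)
  then have deg: "degree q > 0" by (metis degree_eq_zeroE neq0_conv poly_const_conv poly_pCons mult_zero_right poly_0 add_0_right)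
  have "\<exists>n :: nat \<Rightarrow> nat. strict_mono n \<and>
      uniform_limit K (\<lambda>k \<zeta>. g (complex_of_real (r (n k)) * \<zeta>)) \<phi> sequentially"
    if K: "compact K" "K \<subset> circle" and \<phi>: "continuous_on K \<phi>" for K \<phi>
  proof -
    have "\<exists>n\<ge>l. \<forall>\<zeta>\<in>K. dist (g (complex_of_real (r n) * \<zeta>)) (\<phi> \<zeta>) < \<epsilon>" if \<epsilon>: "\<epsilon> > 0" for \<epsilon> l
    proof -
      obtain T where T: "continuous_on K T" "\<And>\<zeta>. \<zeta> \<in> K \<Longrightarrow> dist (poly q (T \<zeta>)) (\<phi> \<zeta>) < \<epsilon>/2"
        using circle_poly_lift_approx[OF deg K \<phi>, of "\<epsilon>/2"] \<epsilon> by auto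
      \<comment> \<open>With targets \<open>T \<zeta> * d j\<close> the limit is
        \<open>q (T \<zeta>)\<close>, already close to \<open>\<phi> \<zeta>\<close>.\<close>
      obtain nk :: "nat \<Rightarrow> nat" where nk: "strict_mono nk"
        "uniform_limit K (\<lambda>k \<zeta>. mpoly_eval P (\<lambda>i. f (\<sigma> i) (complex_of_real (r (nk k)) * \<zeta>)))
          (\<lambda>\<zeta>. mpoly_eval P (\<lambda>i. T \<zeta> * d (\<sigma> i))) sequentially"
        by (rule jointly_universal_mpoly_eval[OF f K _ fin, of "\<lambda>j \<zeta>. T \<zeta> * d j"])
           (auto intro!: continuous_intros T(1))
      have "\<forall>\<^sub>F k in sequentially. \<forall>\<zeta>\<in>K.
          dist (mpoly_eval P (\<lambda>i. f (\<sigma> i) (complex_of_real (r (nk k)) * \<zeta>))) (poly q (T \<zeta>)) < \<epsilon>/2"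
        using uniform_limitD[OF nk(2) half_gt_zero[OF \<epsilon>]] unfolding q .
      then obtain k0 where k0: "\<And>k. k \<ge> k0 \<Longrightarrow> \<forall>\<zeta>\<in>K.
          dist (mpoly_eval P (\<lambda>i. f (\<sigma> i) (complex_of_real (r (nk k)) * \<zeta>))) (poly q (T \<zeta>)) < \<epsilon>/2"
        unfolding eventually_sequentially by blast
      define m where "m = nk (max k0 l)"
      have "m \<ge> l" using seq_suble[OF nk(1), of "max k0 l"] by (simp add: m_def)
      moreover have "dist (g (complex_of_real (r m) * \<zeta>)) (\<phi> \<zeta>) < \<epsilon>" if \<zeta>: "\<zeta> \<in> K" for \<zeta>
      proof -
        have "complex_of_real (r m) * \<zeta> \<in> disc" using r[of m] \<zeta> K(2) by (auto simp: norm_mult)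
        then have "dist (poly q (T \<zeta>)) (g (complex_of_real (r m) * \<zeta>)) < \<epsilon>/2"
          using k0[of "max k0 l"] \<zeta> by (simp add: g_eq m_def dist_commute)
        then show ?thesis using T(2)[OF \<zeta>] by (rule dist_triangle_half_r)
      qed
      ultimately show ?thesis by blast
    qed
    then have "\<exists>n :: nat \<Rightarrow> nat. strict_mono n \<and>
      (\<forall>k. \<forall>\<zeta>\<in>K. dist (g (complex_of_real (r (n k)) * \<zeta>)) (\<phi> \<zeta>) < inverse (real (Suc k)))"
      by (rule strict_mono_choice)
    then obtain n :: "nat \<Rightarrow> nat" where n: "strict_mono n"
      "\<forall>k. \<forall>\<zeta>\<in>K. dist (g (complex_of_real (r (n k)) * \<zeta>)) (\<phi> \<zeta>) < inverse (real (Suc k))"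
      by blast
    have "uniform_limit K (\<lambda>k \<zeta>. g (complex_of_real (r (n k)) * \<zeta>)) \<phi> sequentially"
      by (rule uniform_limit_inverse_Suc) (use n(2) in blast)
    then show ?thesis using n(1) by blast
  qed
  then show ?thesis using ghol unfolding abel_universal_along_def by blast
qed

section \<open>Genericity\<close>

lemma holomorphic_restrict_hol_disc: "f holomorphic_on disc \<Longrightarrow> (\<lambda>z\<in>disc. f z) \<in> hol_disc"
  unfolding hol_disc_def by (auto intro: holomorphic_transform)

lemma radius_sequence_range: "radius_sequence r \<Longrightarrow> r n \<in> {0..<1}"
  unfolding radius_sequence_def by blast

section \<open>Open dense conditions\<close>

text \<open>All parameters range over countable sets: targets are coefficient lists and compact sets
  are complements of basic open sets. The clause \<open>r n > 0\<close> allows the condition to be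
  rewritten in the variable \<open>z = r n * \<zeta>\<close>.\<close>

definition universal_stage ::
    "(nat \<Rightarrow> real) \<Rightarrow> complex list list \<Rightarrow> complex set \<Rightarrow> nat \<Rightarrow> (nat \<Rightarrow> complex \<Rightarrow> complex) set"
  where "universal_stage r ps U l = {F. (\<forall>j. F j \<in> hol_disc) \<and>
    (\<exists>n\<ge>l. r n > 0 \<and> (\<forall>j<length ps. \<forall>\<zeta>\<in>circle - U.
      dist (F j (of_real (r n) * \<zeta>)) (poly (Poly (ps ! j)) \<zeta>) < radius_gap l))}"

definition dense_stage :: "complex list \<Rightarrow> nat \<Rightarrow> (nat \<Rightarrow> complex \<Rightarrow> complex) set"
  where "dense_stage cs k = {F. (\<forall>j. F j \<in> hol_disc) \<and>
    (\<exists>j. \<forall>z\<in>disc_exhaustion k. dist (F j z) (poly (Poly cs) z) < radius_gap k)}"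

lemma openin_universal_stage:
  assumes r: "\<And>n. r n \<in> {0..<1}" and U: "open U"
  shows "openin hol_seq_topology (universal_stage r ps U l)"
proof -
  \<comment> \<open>For fixed \<open>n\<close> the condition is a uniform ball on \<open>L n\<close>
    centred at the rescaled polynomials; the existential over \<open>n\<close> becomes a union of
    open sets.\<close>
  define L where "L = (\<lambda>n. (\<lambda>\<zeta>. of_real (r n) * \<zeta>) ` (circle - U))"
  have "openin hol_seq_topology {F. (\<forall>j. F j \<in> hol_disc) \<and> (\<forall>j<length ps. \<forall>z\<in>L n.
      dist (F j z) (poly (Poly (ps ! j)) (z / of_real (r n))) < radius_gap l)}" if "r n > 0" for n
  proof (rule openin_hol_seq_topology_balls)
    show "compact (L n)"
      unfolding L_def by (intro compact_continuous_image continuous_intros compact_diff U) auto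
    show "L n \<subseteq> disc" using r[of n] by (auto simp: L_def norm_mult)
  qed (use that in \<open>auto intro!: continuous_intros\<close>)
  then have "openin hol_seq_topology (\<Union>n\<in>{n. n \<ge> l \<and> r n > 0}. {F. (\<forall>j. F j \<in> hol_disc) \<and>
      (\<forall>j<length ps. \<forall>z\<in>L n. dist (F j z) (poly (Poly (ps ! j)) (z / of_real (r n))) < radius_gap l)})"
    by (intro openin_Union) blast
  also have "(\<Union>n\<in>{n. n \<ge> l \<and> r n > 0}. {F. (\<forall>j. F j \<in> hol_disc) \<and>
      (\<forall>j<length ps. \<forall>z\<in>L n. dist (F j z) (poly (Poly (ps ! j)) (z / of_real (r n))) < radius_gap l)})
      = universal_stage r ps U l"
    by (auto simp: universal_stage_def L_def)
  finally show ?thesis .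
qed

text \<open>\<open>seq_nbhd F k\<close> restricts functions only on the disc of radius
  \<open>R\<close>. As \<open>r\<close> tends to 1, some circle of radius \<open>r n\<close> with
  \<open>n \<ge> l\<close> lies outside it, and each \<open>F j\<close> can be fused with its target
  there.\<close>

lemma universal_stage_dense:
  assumes r: "radius_sequence r" and U: "open U" "circle \<inter> U \<noteq> {}" and F: "\<And>j. F j \<in> hol_disc"
  shows "seq_nbhd F k \<inter> universal_stage r ps U l \<noteq> {}"
proof -
  define R where "R = 1 - radius_gap k"
  have R: "0 \<le> R" "R < 1" using radius_gap_pos[of k] by (auto simp: R_def radius_gap_def field_simps)
  have "r \<longlonglongrightarrow> 1" using r by (simp add: radius_sequence_def)
  then have "\<forall>\<^sub>F n in sequentially. R < r n" using R(2) by (rule order_tendstoD)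
  then obtain n0 where n0: "\<And>n. n \<ge> n0 \<Longrightarrow> R < r n" by (auto simp: eventually_sequentially)
  define n where "n = max l n0"
  have n: "n \<ge> l" "R < r n" "r n < 1"
    using n0[of n] radius_sequence_range[OF r, of n] by (auto simp: n_def)
  define \<epsilon> where "\<epsilon> = min (radius_gap k) (radius_gap l)"
  have \<epsilon>: "\<epsilon> > 0" by (simp add: \<epsilon>_def radius_gap_pos)
  \<comment> \<open>For \<open>j\<close> beyond the length of \<open>ps\<close> the list
    \<open>ps ! j\<close> is unspecified; the stage does not look at those coordinates, so fusing
    with it is harmless.\<close>
  have ex: "\<forall>j. \<exists>g. g holomorphic_on disc \<and> (\<forall>z\<in>cball 0 R. dist (g z) (F j z) < \<epsilon>) \<and>
      (\<forall>\<zeta>\<in>circle - U. dist (g (of_real (r n) * \<zeta>)) (poly (Poly (ps ! j)) \<zeta>) < \<epsilon>)"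
  proof
    fix j
    have "F j holomorphic_on disc" using F[of j] by (simp add: hol_disc_def)
    moreover have "poly (Poly (ps ! j)) holomorphic_on UNIV" by (intro holomorphic_intros)
    ultimately obtain g where "g holomorphic_on disc" "\<And>z. z \<in> cball 0 R \<Longrightarrow> dist (g z) (F j z) < \<epsilon>"
      "\<And>\<zeta>. \<zeta> \<in> circle - U \<Longrightarrow> dist (g (of_real (r n) * \<zeta>)) (poly (Poly (ps ! j)) \<zeta>) < \<epsilon>"
      by (rule disc_circle_fusion[OF R(1) n(2,3) U \<epsilon>]) blast
    then show "\<exists>g. g holomorphic_on disc \<and> (\<forall>z\<in>cball 0 R. dist (g z) (F j z) < \<epsilon>) \<and>
        (\<forall>\<zeta>\<in>circle - U. dist (g (of_real (r n) * \<zeta>)) (poly (Poly (ps ! j)) \<zeta>) < \<epsilon>)"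
      by blast
  qed
  from choice[OF ex] obtain g where g: "\<And>j. g j holomorphic_on disc"
    "\<And>j z. z \<in> cball 0 R \<Longrightarrow> dist (g j z) (F j z) < \<epsilon>"
    "\<And>j \<zeta>. \<zeta> \<in> circle - U \<Longrightarrow> dist (g j (of_real (r n) * \<zeta>)) (poly (Poly (ps ! j)) \<zeta>) < \<epsilon>"
    by blast
  define G where "G = (\<lambda>j. \<lambda>z\<in>disc. g j z)"
  have G: "G j \<in> hol_disc" for j unfolding G_def by (rule holomorphic_restrict_hol_disc) (rule g)
  have "G \<in> seq_nbhd F k"
    using G g(2) disc_exhaustion_subset[of k]
    by (auto simp: seq_nbhd_def G_def disc_exhaustion_def R_def \<epsilon>_def subset_iff)
  moreover have "G \<in> universal_stage r ps U l"
  proof -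
    have "dist (G j (of_real (r n) * \<zeta>)) (poly (Poly (ps ! j)) \<zeta>) < radius_gap l" if \<zeta>: "\<zeta> \<in> circle - U" for j \<zeta>
    proof -
      have "of_real (r n) * \<zeta> \<in> disc" using \<zeta> n R by (auto simp: norm_mult)
      then show ?thesis using g(3)[OF \<zeta>, of j] by (simp add: G_def \<epsilon>_def)
    qed
    then show ?thesis using G n R unfolding universal_stage_def by (auto intro!: exI[of _ n])
  qed
  ultimately show ?thesis by blast
qed

lemma openin_dense_stage: "openin hol_seq_topology (dense_stage cs k)"
proof -
  have "openin hol_seq_topology (\<Union>j. {F. (\<forall>j. F j \<in> hol_disc) \<and>
      (\<forall>z\<in>disc_exhaustion k. dist (F j z) (poly (Poly cs) z) < radius_gap k)})"
    by (intro openin_Union)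
       (auto intro!: openin_hol_seq_topology_ball compact_disc_exhaustion disc_exhaustion_subset continuous_intros)
  also have "(\<Union>j. {F. (\<forall>j. F j \<in> hol_disc) \<and>
      (\<forall>z\<in>disc_exhaustion k. dist (F j z) (poly (Poly cs) z) < radius_gap k)}) = dense_stage cs k"
    by (auto simp: dense_stage_def)
  finally show ?thesis .
qed

lemma dense_stage_dense:
  assumes F: "\<And>j. F j \<in> hol_disc"
  shows "seq_nbhd F k \<inter> dense_stage cs m \<noteq> {}"
proof -
  \<comment> \<open>\<open>seq_nbhd F k\<close> restricts only the coordinates below
    \<open>k\<close>, so coordinate \<open>k\<close> is free to be the polynomial itself.\<close>
  define G where "G = F(k := \<lambda>z\<in>disc. poly (Poly cs) z)"
  have "(\<lambda>z\<in>disc. poly (Poly cs) z) \<in> hol_disc"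
    by (intro holomorphic_restrict_hol_disc holomorphic_intros)
  then have G: "G j \<in> hol_disc" for j using F by (simp add: G_def)
  have "G \<in> seq_nbhd F k" using G by (simp add: seq_nbhd_def) (simp add: G_def radius_gap_pos)
  moreover have "\<forall>z\<in>disc_exhaustion m. dist (G k z) (poly (Poly cs) z) < radius_gap m"
    using disc_exhaustion_subset[of m] by (auto simp: G_def radius_gap_pos subset_iff)
  then have "G \<in> dense_stage cs m" using G unfolding dense_stage_def by blast
  ultimately show ?thesis by blast
qed

section \<open>From the countable conditions to the theorem\<close>

lemma universal_stages_jointly_universal:
  assumes D: "\<And>U. open U \<Longrightarrow> U \<noteq> {} \<Longrightarrow> \<exists>d\<in>D. d \<in> U"
    and basis: "\<And>z V. open V \<Longrightarrow> z \<in> V \<Longrightarrow> \<exists>U\<in>\<B>. z \<in> U \<and> U \<subseteq> V"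
    and f: "\<And>ps U l. ps \<in> lists (lists D) \<Longrightarrow> U \<in> \<B> \<Longrightarrow> circle \<inter> U \<noteq> {} \<Longrightarrow> f \<in> universal_stage r ps U l"
  shows "jointly_universal r f"
  unfolding jointly_universal_def
proof (intro allI impI, elim conjE)
  fix N l :: nat and K :: "complex set" and \<phi> :: "nat \<Rightarrow> complex \<Rightarrow> complex" and \<epsilon> :: real
  assume K: "compact K" "K \<subset> circle" and \<phi>: "\<forall>j<N. continuous_on K (\<phi> j)" and \<epsilon>: "\<epsilon> > 0"
  have "\<exists>cs\<in>lists D. \<forall>z\<in>K. dist (poly (Poly cs) z) (\<phi> j z) < \<epsilon>/2" if j: "j < N" for j
  proof -
    obtain p where p: "\<And>z. z \<in> K \<Longrightarrow> dist (poly p z) (\<phi> j z) < \<epsilon>/2/2"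
      using continuous_circle_approx_poly[OF K, of "\<phi> j" "\<epsilon>/2/2"] \<phi> j \<epsilon> by auto
    obtain cs where cs: "cs \<in> lists D" "\<forall>z\<in>K. dist (poly (Poly cs) z) (poly p z) < \<epsilon>/2/2"
      using poly_approx_dense_coeffs[OF D compact_imp_bounded[OF K(1)], of "\<epsilon>/2/2" p] \<epsilon> by auto
    have "dist (poly (Poly cs) z) (\<phi> j z) < \<epsilon>/2" if "z \<in> K" for z
    proof -
      have "dist (poly p z) (poly (Poly cs) z) < \<epsilon>/2/2" using cs(2) that by (simp add: dist_commute)
      then show ?thesis using p[OF that] by (rule dist_triangle_half_r)
    qed
    then show ?thesis using cs(1) by blast
  qed
  then have ex: "\<forall>j. \<exists>cs. j < N \<longrightarrow> cs \<in> lists D \<and> (\<forall>z\<in>K. dist (poly (Poly cs) z) (\<phi> j z) < \<epsilon>/2)"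
    by blast
  from choice[OF ex] obtain cs where cs: "\<And>j. j < N \<Longrightarrow> cs j \<in> lists D"
    "\<And>j z. j < N \<Longrightarrow> z \<in> K \<Longrightarrow> dist (poly (Poly (cs j)) z) (\<phi> j z) < \<epsilon>/2" by blast
  define ps where "ps = map cs [0..<N]"
  have ps: "ps \<in> lists (lists D)" "length ps = N" using cs(1) by (auto simp: ps_def in_lists_conv_set)
  obtain \<omega> where \<omega>: "\<omega> \<in> circle" "\<omega> \<notin> K" using psubset_imp_ex_mem[OF K(2)] by auto
  have "open (- K)" using K(1) by (simp add: compact_imp_closed open_Compl)
  \<comment> \<open>A basic neighbourhood of a point missing from \<open>K\<close>, disjoint from
    \<open>K\<close>; hence \<open>K\<close> lies in \<open>circle - U\<close>.\<close>
  then obtain U where U: "U \<in> \<B>" "\<omega> \<in> U" "U \<subseteq> - K" using basis[of "- K" \<omega>] \<omega>(2) by blast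
  have "circle \<inter> U \<noteq> {}" using \<omega>(1) U(2) by blast
  obtain m where m: "radius_gap m < \<epsilon>/2" using radius_gap_arch[of "\<epsilon>/2"] \<epsilon> by auto
  \<comment> \<open>The stage index is both a lower bound for \<open>n\<close> and the label of the
    tolerance; \<open>l + m\<close> meets both demands.\<close>
  have "f \<in> universal_stage r ps U (l + m)" by (rule f) fact+
  then obtain n where n: "n \<ge> l + m" "\<And>j \<zeta>. j < N \<Longrightarrow> \<zeta> \<in> circle - U \<Longrightarrow>
      dist (f j (of_real (r n) * \<zeta>)) (poly (Poly (ps ! j)) \<zeta>) < radius_gap (l + m)"
    unfolding universal_stage_def ps(2) by blast
  have "dist (f j (of_real (r n) * \<zeta>)) (\<phi> j \<zeta>) < \<epsilon>" if j: "j < N" and \<zeta>: "\<zeta> \<in> K" for j \<zeta>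
  proof -
    have "\<zeta> \<in> circle - U" using \<zeta> K(2) U(3) by blast
    then have "dist (f j (of_real (r n) * \<zeta>)) (poly (Poly (cs j)) \<zeta>) < \<epsilon>/2"
      using n(2)[OF j] m radius_gap_antimono[of m "l + m"] j by (fastforce simp: ps_def)
    then have "dist (poly (Poly (cs j)) \<zeta>) (f j (of_real (r n) * \<zeta>)) < \<epsilon>/2" by (simp add: dist_commute)
    then show ?thesis using cs(2)[OF j \<zeta>] by (rule dist_triangle_half_r)
  qed
  moreover have "n \<ge> l" using n(1) by simp
  ultimately show "\<exists>n\<ge>l. \<forall>j<N. \<forall>\<zeta>\<in>K. dist (f j (complex_of_real (r n) * \<zeta>)) (\<phi> j \<zeta>) < \<epsilon>" by blast
qed

lemma generated_subalgebra_member: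
  assumes "f \<in> B" "f \<in> hol_disc"
  shows "f \<in> generated_subalgebra B"
proof -
  define P :: mpoly where "P = Poly_Mapping.single (Poly_Mapping.single 0 1) 1"
  have "f = hol_eval P (\<lambda>_. f)"
    using assms(2) by (auto simp: hol_eval_def mpoly_eval_def P_def hol_disc_def extensional_def fun_eq_iff)
  moreover have "mpoly_vars P \<subseteq> {..<1}" by (auto simp: mpoly_vars_def P_def)
  ultimately show ?thesis unfolding generated_subalgebra_def using assms(1) by blast
qed

lemma generated_subalgebra_subset_hol_disc:
  assumes "B \<subseteq> hol_disc"
  shows "generated_subalgebra B \<subseteq> hol_disc"
proof
  fix g assume "g \<in> generated_subalgebra B"
  then obtain P b n where g: "g = hol_eval P b" "mpoly_vars P \<subseteq> {..<n}" "\<forall>i<n. b i \<in> B"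
    unfolding generated_subalgebra_def by blast
  then have "b i holomorphic_on disc" if "i \<in> mpoly_vars P" for i
    using assms that by (auto simp: hol_disc_def)
  then show "g \<in> hol_disc"
    unfolding g(1) hol_eval_def by (intro holomorphic_restrict_hol_disc mpoly_eval_holomorphic)
qed

lemma dense_stages_dense_subalgebra:
  assumes D: "\<And>U. open U \<Longrightarrow> U \<noteq> {} \<Longrightarrow> \<exists>d\<in>D. d \<in> U" and f: "\<And>j. f j \<in> hol_disc"
    and stage: "\<And>cs k. cs \<in> lists D \<Longrightarrow> f \<in> dense_stage cs k"
  shows "dense_in hol_topology (generated_subalgebra (range f))"
proof -
  have sub: "generated_subalgebra (range f) \<subseteq> topspace hol_topology"
    unfolding topspace_hol_topology using f by (intro generated_subalgebra_subset_hol_disc) auto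
  have "g \<in> hol_topology closure_of generated_subalgebra (range f)" if g: "g \<in> topspace hol_topology" for g
    unfolding in_closure_of
  proof (intro conjI allI impI g)
    fix T assume T: "g \<in> T \<and> openin hol_topology T"
    obtain k where k: "{h \<in> hol_disc. \<forall>z\<in>disc_exhaustion k. dist (h z) (g z) < radius_gap k} \<subseteq> T"
      using openin_hol_topology_nbhd[of T g] T by blast
    have ghol: "g holomorphic_on ball 0 1" using g by (simp add: topspace_hol_topology hol_disc_def)
    obtain m where m: "radius_gap m < radius_gap k / 2"
      using radius_gap_arch[of "radius_gap k / 2"] radius_gap_pos[of k] by auto
    \<comment> \<open>Raising the index enlarges the disc and shrinks the tolerance. The error
      splits into two quarters of \<open>radius_gap k\<close> for \<open>p\<close> and its
      coefficients, and less than half for \<open>f j\<close>.\<close>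
    define M where "M = k + m"
    have M: "disc_exhaustion k \<subseteq> disc_exhaustion M" "radius_gap M < radius_gap k / 2"
      using m radius_gap_antimono[of m M] by (auto simp: M_def intro!: disc_exhaustion_mono)
    have e: "radius_gap k / 2 / 2 > 0" "1 - radius_gap M < 1" using radius_gap_pos[of k] radius_gap_pos[of M] by auto
    obtain p where p: "\<And>z. z \<in> disc_exhaustion M \<Longrightarrow> dist (poly p z) (g z) < radius_gap k / 2 / 2"
      using holomorphic_approx_poly[OF ghol e(2,1)] unfolding disc_exhaustion_def by blast
    obtain cs where cs: "cs \<in> lists D"
      "\<forall>z\<in>disc_exhaustion M. dist (poly (Poly cs) z) (poly p z) < radius_gap k / 2 / 2"
      using poly_approx_dense_coeffs[OF D compact_imp_bounded[OF compact_disc_exhaustion] e(1)] by blast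
    obtain j where j: "\<forall>z\<in>disc_exhaustion M. dist (f j z) (poly (Poly cs) z) < radius_gap M"
      using stage[OF cs(1), of M] unfolding dense_stage_def by blast
    have "dist (f j z) (g z) < radius_gap k" if "z \<in> disc_exhaustion k" for z
    proof -
      have z: "z \<in> disc_exhaustion M" using that M(1) by blast
      have "dist (f j z) (g z) \<le> dist (f j z) (poly (Poly cs) z) + (dist (poly (Poly cs) z) (poly p z) + dist (poly p z) (g z))"
        by (meson add_left_mono dist_triangle order_trans)
      then show ?thesis using bspec[OF j z] bspec[OF cs(2) z] p[OF z] M(2) by linarith
    qed
    then have "f j \<in> T" using k f by blast
    moreover have "f j \<in> generated_subalgebra (range f)" using f by (intro generated_subalgebra_member) auto
    ultimately show "\<exists>h. h \<in> generated_subalgebra (range f) \<and> h \<in> T" by blast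
  qed
  then have "topspace hol_topology \<subseteq> hol_topology closure_of generated_subalgebra (range f)"
    by (rule subsetI)
  then show ?thesis
    unfolding dense_in_def by (intro conjI sub subset_antisym closure_of_subset_topspace)
qed

text \<open>Universality is kept along the given \<open>r\<close>: the residual part needs only the
  weaker \<open>abel_universal\<close>, whereas algebrability needs this sharper form.\<close>

lemma residual_universal_generators:
  assumes r: "radius_sequence r"
  obtains G where "gdelta_in hol_seq_topology G" "dense_in hol_seq_topology G"
    "\<And>f. f \<in> G \<Longrightarrow> range f \<subseteq> hol_disc \<and> freely_generating f \<and>
      dense_in hol_topology (generated_subalgebra (range f)) \<and>
      generated_subalgebra (range f) - hol_constants \<subseteq> abel_universal_along r"
proof -
  note r01 = radius_sequence_range[OF r]
  obtain D :: "complex set" where D: "countable D" "\<And>U. open U \<Longrightarrow> U \<noteq> {} \<Longrightarrow> \<exists>d\<in>D. d \<in> U"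
    using countable_dense_exists by blast
  obtain \<B> :: "complex set set" where \<B>: "countable \<B>" "topological_basis \<B>"
    using ex_countable_basis by blast
  define A where "A = lists (lists D) \<times> {U \<in> \<B>. circle \<inter> U \<noteq> {}} \<times> (UNIV :: nat set)"
  \<comment> \<open>A disjoint sum merges both countable families of conditions, so a single Baire
    argument provides universality and density together.\<close>
  define I where "I = A <+> lists D \<times> (UNIV :: nat set)"
  define S where "S = case_sum (\<lambda>(ps, U, l). universal_stage r ps U l) (\<lambda>(cs, k). dense_stage cs k)"
  have opn: "open U" if "U \<in> \<B>" for U using topological_basis_open[OF \<B>(2) that] .
  have cnt: "countable I" unfolding I_def A_def
    using D(1) \<B>(1) by (intro countable_Plus countable_SIGMA countable_lists countable_Collect) auto
  have ne: "I \<noteq> {}" by (auto simp: I_def)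
  have opS: "openin hol_seq_topology (S i)" if "i \<in> I" for i
    using that openin_universal_stage[OF r01 opn] openin_dense_stage
    unfolding I_def A_def S_def by auto
  have dnS: "seq_nbhd F k \<inter> S i \<noteq> {}" if i: "i \<in> I" and F: "\<And>j. F j \<in> hol_disc" for i F k
  proof (cases i)
    case (Inl a)
    then obtain ps U l where a: "i = Inl (ps, U, l)" "U \<in> \<B>" "circle \<inter> U \<noteq> {}"
      using i by (auto simp: I_def A_def)
    then show ?thesis using universal_stage_dense[OF r opn[OF a(2)] a(3) F] by (simp add: S_def)
  next
    case (Inr b)
    then show ?thesis using dense_stage_dense[OF F] by (cases b) (simp add: S_def)
  qed
  note G = hol_seq_dense_gdelta[OF cnt ne opS dnS]
  show thesis
  proof (rule that[OF G])
    fix f assume f: "f \<in> (\<Inter>i\<in>I. S i)"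
    have uni: "f \<in> universal_stage r ps U l" if "ps \<in> lists (lists D)" "U \<in> \<B>" "circle \<inter> U \<noteq> {}" for ps U l
    proof -
      have "Inl (ps, U, l) \<in> I" using that unfolding I_def A_def by (intro InlI SigmaI) auto
      then show ?thesis using f unfolding S_def by fastforce
    qed
    have den: "f \<in> dense_stage cs k" if "cs \<in> lists D" for cs k
    proof -
      have "Inr (cs, k) \<in> I" using that unfolding I_def by (intro InrI SigmaI) auto
      then show ?thesis using f unfolding S_def by fastforce
    qed
    have hol: "f j \<in> hol_disc" for j using den[of "[]" 0] by (auto simp: dense_stage_def)
    have ju: "jointly_universal r f"
    proof (rule universal_stages_jointly_universal[OF D(2) _ uni])
      show "\<exists>U\<in>\<B>. z \<in> U \<and> U \<subseteq> V" if "open V" "z \<in> V" for z V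
        using topological_basisE[OF \<B>(2) that] by blast
    qed
    show "range f \<subseteq> hol_disc \<and> freely_generating f \<and>
        dense_in hol_topology (generated_subalgebra (range f)) \<and>
        generated_subalgebra (range f) - hol_constants \<subseteq> abel_universal_along r"
    proof (intro conjI)
      show "range f \<subseteq> hol_disc" using hol by blast
      show "freely_generating f"
        unfolding freely_generating_def
        using jointly_universal_inj[OF ju] jointly_universal_algebraically_independent[OF ju r01] by blast
      show "dense_in hol_topology (generated_subalgebra (range f))"
        by (rule dense_stages_dense_subalgebra[OF D(2) hol den])
      show "generated_subalgebra (range f) - hol_constants \<subseteq> abel_universal_along r"
        using jointly_universal_nonconstant[OF ju r01 hol] by blast
    qed
  qed
qed

theorem theorem2p9:
  fixes r :: "nat \<Rightarrow> real"
  assumes "radius_sequence r"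
  shows "residual_in hol_seq_topology
           {f. range f \<subseteq> hol_disc \<and> freely_generating f \<and>
               dense_in hol_topology (generated_subalgebra (range f)) \<and>
               generated_subalgebra (range f) - hol_constants \<subseteq> abel_universal} \<and>
         densely_strongly_algebrable (abel_universal_along r)"
proof -
  obtain G where G: "gdelta_in hol_seq_topology G" "dense_in hol_seq_topology G"
    "\<And>f. f \<in> G \<Longrightarrow> range f \<subseteq> hol_disc \<and> freely_generating f \<and>
      dense_in hol_topology (generated_subalgebra (range f)) \<and>
      generated_subalgebra (range f) - hol_constants \<subseteq> abel_universal_along r"
    by (rule residual_universal_generators[OF assms]) blast
  have sub: "abel_universal_along r \<subseteq> abel_universal"
    using assms unfolding abel_universal_def by blast
  have "G \<subseteq> {f. range f \<subseteq> hol_disc \<and> freely_generating f \<and>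
               dense_in hol_topology (generated_subalgebra (range f)) \<and>
               generated_subalgebra (range f) - hol_constants \<subseteq> abel_universal}"
    using G(3) sub by blast
  moreover have "{f. range f \<subseteq> hol_disc \<and> freely_generating f \<and>
               dense_in hol_topology (generated_subalgebra (range f)) \<and>
               generated_subalgebra (range f) - hol_constants \<subseteq> abel_universal} \<subseteq> topspace hol_seq_topology"
    unfolding topspace_hol_seq_topology by auto
  ultimately have "residual_in hol_seq_topology
           {f. range f \<subseteq> hol_disc \<and> freely_generating f \<and>
               dense_in hol_topology (generated_subalgebra (range f)) \<and>
               generated_subalgebra (range f) - hol_constants \<subseteq> abel_universal}"
    unfolding residual_in_def using G(1,2) by blast
  moreover have "densely_strongly_algebrable (abel_universal_along r)"
  proof -
    \<comment> \<open>The zero sequence shows that the space is nonempty, so its dense subset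
      \<open>G\<close> has a member, which supplies the generators.\<close>
    have "(\<lambda>_. \<lambda>z\<in>disc. 0) \<in> topspace hol_seq_topology"
      unfolding topspace_hol_seq_topology by (auto intro!: holomorphic_restrict_hol_disc)
    then have "G \<noteq> {}" using G(2) unfolding dense_in_def by auto
    then obtain f where f: "range f \<subseteq> hol_disc" "freely_generating f"
      "dense_in hol_topology (generated_subalgebra (range f))"
      "generated_subalgebra (range f) - hol_constants \<subseteq> abel_universal_along r"
      using G(3) by blast
    have "infinite (range f)" using f(2) by (simp add: freely_generating_def finite_image_iff)
    then show ?thesis
      using f unfolding densely_strongly_algebrable_def freely_generating_def by blast
  qed
  ultimately show ?thesis by blast
qed

end
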